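(* Let $d\geq 2$, $N\geq 1$, let $A,B\in\mathbb{C}^{N,N}$ be simultaneously diagonalizable (over $\mathbb{C}$), let every eigenvalue of $A$ have positive real part, and let $S\in\mathbb{R}^{d,d}$ be skew-symmetric. Let $T(0)=I$ and, for $t>0$, $[T(t)v](x)=\int_{\mathbb{R}^d}H(x,\xi,t)v(\xi)\,d\xi$ with $$H(x,\xi,t)=(4\pi tA)^{-\frac d2}\exp\left(-Bt-(4tA)^{-1}|e^{tS}x-\xi|^2\right).$$ Then $(T(t))_{t\geq0}$ is a $C_0$-semigroup (strongly continuous semigroup) on $C_{\mathrm{rub}}(\mathbb{R}^d,\mathbb{C}^N)$, i.e. $$\lim_{t\downarrow0}\|T(t)v-v\|_{C_{\mathrm b}(\mathbb{R}^d,\mathbb{C}^N)}=0\qquad\text{for all }v\in C_{\mathrm{rub}}(\mathbb{R}^d,\mathbb{C}^N).$$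
   Context: $C_{\mathrm b}(\mathbb{R}^d,\mathbb{C}^N)$ is the space of bounded continuous functions with the sup-norm; $C_{\mathrm{ub}}(\mathbb{R}^d,\mathbb{C}^N)$ is its subspace of uniformly continuous functions; and $$C_{\mathrm{rub}}(\mathbb{R}^d,\mathbb{C}^N)=\Big\{v\in C_{\mathrm{ub}}(\mathbb{R}^d,\mathbb{C}^N):\lim_{t\to0}\sup_{x\in\mathbb{R}^d}|v(e^{-tS}x)-v(x)|=0\Big\},$$ a closed subspace of $C_{\mathrm b}(\mathbb{R}^d,\mathbb{C}^N)$, equipped with the sup-norm. Matrix powers: if $A=Y\,\mathrm{diag}(\lambda_k)\,Y^{-1}$ then $(4\pi tA)^{-d/2}=Y\,\mathrm{diag}\big((4\pi t\lambda_k)^{-d/2}\big)\,Y^{-1}$, with $z^{-d/2}=\exp(-\frac d2\mathrm{Log}\,z)$ and $\mathrm{Log}$ the principal logarithm. *)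

theory Defs
  imports "HOL-Analysis.Analysis"
begin

text \<open>The entrywise type class product on \<open>'a ^ 'n ^ 'n\<close> is not matrix multiplication, so
  \<open>(^)\<close> and \<open>exp\<close> are not available for matrices; powers and exponential are introduced here.\<close>

primrec mat_pow :: "'a::semiring_1 ^ 'n ^ 'n \<Rightarrow> nat \<Rightarrow> 'a ^ 'n ^ 'n" where
  "mat_pow A 0 = mat 1"
| "mat_pow A (Suc k) = A ** mat_pow A k"

definition mat_exp :: "'a::real_normed_field ^ 'n ^ 'n \<Rightarrow> 'a ^ 'n ^ 'n" where
  "mat_exp A = (\<Sum>k. (1 / fact k) *\<^sub>R mat_pow A k)"

definition diag_mat :: "('n \<Rightarrow> 'a::zero) \<Rightarrow> 'a ^ 'n ^ 'n" where
  "diag_mat l = (\<chi> i j. if i = j then l i else 0)"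

definition simultaneously_diagonalizable :: "'a::field ^ 'n ^ 'n \<Rightarrow> 'a ^ 'n ^ 'n \<Rightarrow> bool" where
  "simultaneously_diagonalizable A B \<longleftrightarrow>
     (\<exists>(Y :: 'a ^ 'n ^ 'n) a b. invertible Y \<and> A = Y ** diag_mat a ** matrix_inv Y \<and> B = Y ** diag_mat b ** matrix_inv Y)"

definition mat_eigenvalue :: "'a::field ^ 'n ^ 'n \<Rightarrow> 'a \<Rightarrow> bool" where
  "mat_eigenvalue A l \<longleftrightarrow> (\<exists>v. v \<noteq> 0 \<and> A *v v = l *s v)"

text \<open>The matrix power \<open>M\<close> to the exponent \<open>p\<close>, for diagonalizable \<open>M\<close>, with the principal branch
  \<open>z\<^sup>p = exp (p Ln z)\<close>. It does not depend on the diagonalization: see \<open>mat_cpow_eq\<close> below.\<close>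

definition mat_cpow :: "complex ^ 'n ^ 'n \<Rightarrow> complex \<Rightarrow> complex ^ 'n ^ 'n" where
  "mat_cpow M p = (THE P. \<exists>(Y :: complex ^ 'n ^ 'n) l. invertible Y \<and> M = Y ** diag_mat l ** matrix_inv Y \<and>
       P = Y ** diag_mat (\<lambda>k. exp (p * Ln (l k))) ** matrix_inv Y)"

definition sup_norm :: "('a \<Rightarrow> 'b::real_normed_vector) \<Rightarrow> real" where
  "sup_norm v = (SUP x. norm (v x))"

definition C_ub :: "(real ^ 'd \<Rightarrow> complex ^ 'n) set" where
  "C_ub = {v \<in> bcontfun. uniformly_continuous_on UNIV v}"

definition C_rub :: "real ^ 'd ^ 'd \<Rightarrow> (real ^ 'd \<Rightarrow> complex ^ 'n) set" where
  "C_rub S = {v \<in> C_ub.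
     ((\<lambda>t. SUP x. norm (v (mat_exp (- t *\<^sub>R S) *v x) - v x)) \<longlongrightarrow> 0) (at 0)}"

definition heat_kernel :: "complex ^ 'n ^ 'n \<Rightarrow> complex ^ 'n ^ 'n \<Rightarrow> real ^ 'd ^ 'd \<Rightarrow>
    real ^ 'd \<Rightarrow> real ^ 'd \<Rightarrow> real \<Rightarrow> complex ^ 'n ^ 'n" where
  "heat_kernel A B S x \<xi> t =
     mat_cpow ((4 * pi * t) *\<^sub>R A) (- (of_nat CARD('d) / 2)) **
     mat_exp (- (t *\<^sub>R B) -
       ((norm (mat_exp (t *\<^sub>R S) *v x - \<xi>))\<^sup>2) *\<^sub>R matrix_inv ((4 * t) *\<^sub>R A))"

definition semigroup_T :: "complex ^ 'n ^ 'n \<Rightarrow> complex ^ 'n ^ 'n \<Rightarrow> real ^ 'd ^ 'd \<Rightarrow>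
    real \<Rightarrow> (real ^ 'd \<Rightarrow> complex ^ 'n) \<Rightarrow> real ^ 'd \<Rightarrow> complex ^ 'n" where
  "semigroup_T A B S t v =
     (if t = 0 then v else (\<lambda>x. \<integral>\<xi>. heat_kernel A B S x \<xi> t *v v \<xi> \<partial>lborel))"

text \<open>\<open>X\<close> is a complex linear space of bounded functions carrying the sup-norm. The first three
  clauses say that each \<open>T t\<close> with \<open>t \<ge> 0\<close> restricts to a bounded complex-linear operator on \<open>X\<close>.\<close>

definition C0_semigroup_on ::
    "('a \<Rightarrow> complex ^ 'n) set \<Rightarrow> (real \<Rightarrow> ('a \<Rightarrow> complex ^ 'n) \<Rightarrow> 'a \<Rightarrow> complex ^ 'n) \<Rightarrow> bool" where
  "C0_semigroup_on X T \<longleftrightarrow>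
     (\<forall>t\<ge>0. \<forall>v\<in>X. T t v \<in> X) \<and>
     (\<forall>t\<ge>0. \<forall>v\<in>X. \<forall>w\<in>X. \<forall>c. T t (\<lambda>x. c *s v x + w x) = (\<lambda>x. c *s T t v x + T t w x)) \<and>
     (\<forall>t\<ge>0. \<exists>K. \<forall>v\<in>X. sup_norm (T t v) \<le> K * sup_norm v) \<and>
     (\<forall>v\<in>X. T 0 v = v) \<and>
     (\<forall>s\<ge>0. \<forall>t\<ge>0. \<forall>v\<in>X. T (s + t) v = T s (T t v)) \<and>
     (\<forall>v\<in>X. ((\<lambda>t. sup_norm (\<lambda>x. T t v x - v x)) \<longlongrightarrow> 0) (at_right 0))"

lemma diag_mat_mult_nth:
  "(diag_mat l ** P) $ i $ j = l i * P $ i $ j" "(P ** diag_mat l) $ i $ j = P $ i $ j * l j"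
  for P :: "'a::comm_semiring_1 ^ 'n ^ 'n"
  by (simp_all add: diag_mat_def matrix_matrix_mult_def if_distrib if_distribR cong: if_cong)

lemma diag_calculus_unique:
  fixes Y Z :: "'a::field ^ 'n ^ 'n"
  assumes Y: "invertible Y" and Z: "invertible Z"
    and eq: "Y ** diag_mat l ** matrix_inv Y = Z ** diag_mat m ** matrix_inv Z"
  shows "Y ** diag_mat (\<lambda>k. f (l k)) ** matrix_inv Y = Z ** diag_mat (\<lambda>k. f (m k)) ** matrix_inv Z"
proof -
  define P where "P = matrix_inv Z ** Y"
  have YY: "matrix_inv Y ** Y = mat 1" "Y ** matrix_inv Y = mat 1"
    and ZZ: "matrix_inv Z ** Z = mat 1" "Z ** matrix_inv Z = mat 1"
    using someI_ex[OF Y[unfolded invertible_def]] someI_ex[OF Z[unfolded invertible_def]]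
    by (simp_all add: matrix_inv_def)
  have ZP: "Z ** P = Y"
    by (simp add: P_def matrix_mul_assoc ZZ)
  have conv: "P ** diag_mat g = diag_mat h ** P \<longleftrightarrow>
      Y ** diag_mat g ** matrix_inv Y = Z ** diag_mat h ** matrix_inv Z" for g h
  proof
    assume *: "P ** diag_mat g = diag_mat h ** P"
    have "Y ** diag_mat g ** matrix_inv Y = Z ** (P ** diag_mat g) ** matrix_inv Y"
      by (simp add: matrix_mul_assoc ZP)
    also have "\<dots> = Z ** diag_mat h ** matrix_inv Z ** (Y ** matrix_inv Y)"
      unfolding * by (simp only: P_def matrix_mul_assoc)
    finally show "Y ** diag_mat g ** matrix_inv Y = Z ** diag_mat h ** matrix_inv Z"
      by (simp add: YY)
  next
    assume *: "Y ** diag_mat g ** matrix_inv Y = Z ** diag_mat h ** matrix_inv Z"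
    have "P ** diag_mat g = matrix_inv Z ** Y ** diag_mat g ** (matrix_inv Y ** Y)"
      by (simp add: P_def YY)
    also have "\<dots> = matrix_inv Z ** (Y ** diag_mat g ** matrix_inv Y) ** Y"
      by (simp only: matrix_mul_assoc)
    also have "\<dots> = (matrix_inv Z ** Z) ** diag_mat h ** matrix_inv Z ** Y"
      by (simp only: * matrix_mul_assoc)
    finally show "P ** diag_mat g = diag_mat h ** P"
      by (simp add: P_def ZZ matrix_mul_assoc)
  qed
  have "P $ i $ j * f (l j) = f (m i) * P $ i $ j" for i j
  proof -
    have "P $ i $ j * l j = m i * P $ i $ j"
      using eq[folded conv] by (metis diag_mat_mult_nth)
    then show ?thesis by (cases "P $ i $ j = 0") auto
  qed
  then show ?thesis
    unfolding conv[symmetric] by (simp only: vec_eq_iff diag_mat_mult_nth simp_thms)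
qed

lemma mat_cpow_eq:
  fixes Y :: "complex ^ 'n ^ 'n"
  assumes "invertible Y" and "M = Y ** diag_mat l ** matrix_inv Y"
  shows "mat_cpow M p = Y ** diag_mat (\<lambda>k. exp (p * Ln (l k))) ** matrix_inv Y"
  unfolding mat_cpow_def
proof (rule the_equality)
  fix P
  assume "\<exists>(Y :: complex ^ 'n ^ 'n) l. invertible Y \<and> M = Y ** diag_mat l ** matrix_inv Y \<and>
       P = Y ** diag_mat (\<lambda>k. exp (p * Ln (l k))) ** matrix_inv Y"
  then show "P = Y ** diag_mat (\<lambda>k. exp (p * Ln (l k))) ** matrix_inv Y"
    using assms diag_calculus_unique[where f = "\<lambda>z. exp (p * Ln z)"] by metis
qed (use assms in blast)

lemma norm_mat_pow_nth_le:
  fixes A :: "'a::real_normed_field ^ 'n ^ 'n"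
  shows "norm (mat_pow A k $ i $ j) \<le> (real CARD('n) * norm A) ^ k"
proof (induction k arbitrary: i j)
  case 0
  then show ?case by (simp add: mat_def)
next
  case (Suc k)
  have "norm (mat_pow A (Suc k) $ i $ j) \<le> (\<Sum>m\<in>UNIV. norm (A $ i $ m) * norm (mat_pow A k $ m $ j))"
    by (simp add: matrix_matrix_mult_def norm_mult[symmetric] norm_sum)
  also have "\<dots> \<le> (\<Sum>m\<in>(UNIV::'n set). norm A * (real CARD('n) * norm A) ^ k)"
    by (intro sum_mono mult_mono Suc.IH) (auto intro: order_trans[OF Finite_Cartesian_Product.norm_nth_le Finite_Cartesian_Product.norm_nth_le])
  finally show ?case by (simp add: ac_simps)
qed

lemma mat_exp_sums:
  fixes A :: "'a::{real_normed_field, banach} ^ 'n ^ 'n"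
  shows "(\<lambda>k. (1 / fact k) *\<^sub>R mat_pow A k) sums mat_exp A"
proof -
  have "summable (\<lambda>k. (1 / fact k) *\<^sub>R mat_pow A k)"
  proof (rule summable_comparison_test)
    let ?n = "real CARD('n)"
    have "norm ((1 / fact k) *\<^sub>R mat_pow A k) \<le> ?n * ?n * ((?n * norm A) ^ k /\<^sub>R fact k)" for k
    proof -
      have "norm (mat_pow A k) \<le> (\<Sum>i\<in>UNIV. norm (mat_pow A k $ i))"
        unfolding norm_vec_def by (intro L2_set_le_sum) simp
      also have "\<dots> \<le> (\<Sum>i\<in>(UNIV::'n set). \<Sum>j\<in>(UNIV::'n set). norm (mat_pow A k $ i $ j))"
        unfolding norm_vec_def by (intro sum_mono L2_set_le_sum) simp
      also have "\<dots> \<le> (\<Sum>i\<in>(UNIV::'n set). \<Sum>j\<in>(UNIV::'n set). (?n * norm A) ^ k)"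
        by (intro sum_mono norm_mat_pow_nth_le)
      finally have "norm (mat_pow A k) \<le> ?n * ?n * (?n * norm A) ^ k"
        by (simp add: mult.assoc)
      then show ?thesis by (simp add: field_simps)
    qed
    then show "\<exists>N. \<forall>k\<ge>N. norm ((1 / fact k) *\<^sub>R mat_pow A k) \<le>
        ?n * ?n * ((?n * norm A) ^ k /\<^sub>R fact k)"
      by blast
    show "summable (\<lambda>k. ?n * ?n * ((?n * norm A) ^ k /\<^sub>R fact k))"
      by (intro summable_mult summable_exp_generic)
  qed
  then show ?thesis unfolding mat_exp_def by (rule summable_sums)
qed

end

theory Submission
  imports Defs "HOL-Probability.Distributions" "HOL-Complex_Analysis.Conformal_Mappings"
begin

text \<open>In a common eigenbasis of \<open>A\<close> and \<open>B\<close> the operator \<open>T(t)\<close> acts on the coordinate belonging to the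
  eigenvalues \<open>a\<close>, \<open>b\<close> as \<open>f \<mapsto> exp(-tb) (h\<^bsub>ta\<^esub> * f) \<circ> exp(tS)\<close>, where \<open>h\<^bsub>z\<^esub>\<close> is the Gaussian heat kernel with
  complex parameter \<open>z\<close>. This kernel has integral 1 (by analytic continuation from real \<open>z\<close>), \<open>h\<^bsub>sa\<^esub> * h\<^bsub>ta\<^esub> = h\<^bsub>(s+t)a\<^esub>\<close>,
  an \<open>L\<^sup>1\<close> norm independent of \<open>t\<close> and a second absolute moment of order \<open>t\<close>. Since \<open>exp(tS)\<close> is a one-parameter group
  of rotations and the kernel is radial, convolution commutes with the flow; this gives the semigroup law and
  the invariance of the space. A uniformly continuous bounded \<open>f\<close> satisfies
  \<open>\<bar>f(y) - f(x)\<bar> \<le> \<epsilon> + L \<bar>y - x\<bar>\<^sup>2\<close>, so the second moment bounds \<open>h\<^bsub>ta\<^esub> * f - f\<close> by \<open>C \<epsilon> + L C t\<close> uniformly.\<close>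

section \<open>Complex Gaussian integrals\<close>

text \<open>The integrand is \<open>sqrt (pi / c)\<close> times the normal density of mean 0 and
  variance \<open>1 / (2 * c)\<close>, so mass and second moment of that density give all three
  claims.\<close>

lemma
  assumes c: "(c::real) > 0"
  shows integrable_gauss: "integrable lborel (\<lambda>x::real. exp (- c * x\<^sup>2))"
    and integrable_gauss_moment2: "integrable lborel (\<lambda>x::real. x\<^sup>2 * exp (- c * x\<^sup>2))"
    and integral_gauss: "(\<integral>(x::real). exp (- c * x\<^sup>2) \<partial>lborel) = sqrt (pi / c)"
proof -
  define \<sigma> where "\<sigma> = sqrt (1 / (2 * c))"
  have s: "\<sigma> > 0" "\<sigma>\<^sup>2 = 1 / (2 * c)"
    using c by (auto simp: \<sigma>_def)
  have e: "exp (- c * x\<^sup>2) = sqrt (pi / c) * normal_density 0 \<sigma> x" for x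
    using c s by (simp add: normal_density_def real_sqrt_divide)
  show "integrable lborel (\<lambda>x::real. exp (- c * x\<^sup>2))"
    unfolding e using s by auto
  show "(\<integral>(x::real). exp (- c * x\<^sup>2) \<partial>lborel) = sqrt (pi / c)"
    unfolding e using s by simp
  have "integrable lborel (\<lambda>x. sqrt (pi / c) * (normal_density 0 \<sigma> x * (x - 0) ^ 2))"
    using s by (intro integrable_mult_right integrable_normal_moment)
  then show "integrable lborel (\<lambda>x::real. x\<^sup>2 * exp (- c * x\<^sup>2))"
    unfolding e by (simp add: ac_simps)
qed

text \<open>As functions of \<alpha> both sides are holomorphic on the right half-plane and agree on
  the positive reals, where the real formula applies; the identity theorem does the rest. Holomorphy
  of the left side is differentiation under the integral sign.\<close>

lemma
  assumes "Re \<alpha> > 0"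
  shows integrable_gauss_complex: "integrable lborel (\<lambda>x::real. exp (- \<alpha> * of_real (x\<^sup>2)))"
    and integral_gauss_complex:
      "(\<integral>(x::real). exp (- \<alpha> * of_real (x\<^sup>2)) \<partial>lborel) = exp (Ln (of_real pi / \<alpha>) / 2)"
proof -
  have int: "integrable lborel (\<lambda>x::real. exp (- \<alpha> * of_real (x\<^sup>2)))" if "Re \<alpha> > 0" for \<alpha>
    by (rule Bochner_Integration.integrable_bound[OF integrable_gauss[OF that]])
      (auto simp: norm_exp_eq_Re intro!: borel_measurable_continuous_onI continuous_intros)
  show "integrable lborel (\<lambda>x::real. exp (- \<alpha> * of_real (x\<^sup>2)))"
    by (rule int) fact
  define F :: "complex \<Rightarrow> complex" where "F = (\<lambda>\<alpha>. \<integral>(x::real). exp (- \<alpha> * of_real (x\<^sup>2)) \<partial>lborel)"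
  let ?H = "{z. Re z > 0}"
  have der: "(F has_field_derivative (\<integral>(x::real). - of_real (x\<^sup>2) * exp (- \<alpha> * of_real (x\<^sup>2)) \<partial>lborel)) (at \<alpha>)"
    if a: "Re \<alpha> > 0" for \<alpha>
  proof -
    \<comment> \<open>Halving puts \<alpha> inside the open half-plane \<open>Re z > c\<close>, on
      which the derivatives of all integrands share the integrable bound
      \<open>x\<^sup>2 * exp (- c * x\<^sup>2)\<close>.\<close>
    define c where "c = Re \<alpha> / 2"
    have c: "c > 0" "Re \<alpha> > c" using a by (auto simp: c_def)
    let ?S = "{z. Re z > c}"
    have S: "open ?S" "convex ?S"
      by (auto simp: open_halfspace_Re_gt convex_halfspace_Re_gt)
    \<comment> \<open>Mean value inequality on the convex half-plane; divided by
      \<open>norm (y - \<alpha>)\<close> it dominates the difference quotients.\<close>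
    have lip: "norm (exp (- (y::complex) * of_real (x\<^sup>2)) - exp (- \<alpha> * of_real (x\<^sup>2))) \<le> x\<^sup>2 * exp (- c * x\<^sup>2) * norm (y - \<alpha>)"
      if "y \<in> ?S" for y and x :: real
    proof (rule field_differentiable_bound[OF S(2)])
      fix z assume z: "z \<in> ?S"
      show "((\<lambda>z. exp (- z * of_real (x\<^sup>2))) has_field_derivative - of_real (x\<^sup>2) * exp (- z * of_real (x\<^sup>2))) (at z within ?S)"
        by (auto intro!: derivative_eq_intros)
      have "c * x\<^sup>2 \<le> Re z * x\<^sup>2" using z by (intro mult_right_mono) auto
      then show "norm (- of_real (x\<^sup>2) * exp (- z * of_real (x\<^sup>2))) \<le> x\<^sup>2 * exp (- c * x\<^sup>2)"
        by (auto simp: norm_mult norm_exp_eq_Re norm_power intro!: mult_left_mono)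
    qed (use that c in auto)
    have "(F has_field_derivative (\<integral>(x::real). - of_real (x\<^sup>2) * exp (- \<alpha> * of_real (x\<^sup>2)) \<partial>lborel)) (at \<alpha> within ?S)"
      unfolding has_field_derivative_iff tendsto_at_iff_sequentially
    proof (intro allI impI)
      fix X assume X: "\<forall>i. X i \<in> ?S - {\<alpha>}" "X \<longlonglongrightarrow> \<alpha>"
      let ?q = "\<lambda>y x. (exp (- y * of_real (x\<^sup>2)) - exp (- \<alpha> * of_real (x\<^sup>2))) / (y - \<alpha>)"
      have Fq: "(F (X i) - F \<alpha>) / (X i - \<alpha>) = (\<integral>(x::real). ?q (X i) x \<partial>lborel)" for i
      proof -
        have "Re (X i) > 0" using X(1) c by (metis DiffD1 mem_Collect_eq order_less_trans)
        then show ?thesis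
          unfolding F_def using int a by (subst integral_divide_zero) (subst Bochner_Integration.integral_diff, auto)
      qed
      show "((\<lambda>y. (F y - F \<alpha>) / (y - \<alpha>)) \<circ> X) \<longlonglongrightarrow> (\<integral>(x::real). - of_real (x\<^sup>2) * exp (- \<alpha> * of_real (x\<^sup>2)) \<partial>lborel)"
        unfolding comp_def Fq
      proof (rule integral_dominated_convergence[where w = "\<lambda>x. x\<^sup>2 * exp (- c * x\<^sup>2)"])
        show "integrable lborel (\<lambda>x. x\<^sup>2 * exp (- c * x\<^sup>2))"
          by (rule integrable_gauss_moment2) fact
        show "AE x in lborel. (\<lambda>i. ?q (X i) x) \<longlonglongrightarrow> - of_real (x\<^sup>2) * exp (- \<alpha> * of_real (x\<^sup>2))"
        proof (rule AE_I2)
          fix x :: real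
          have "((\<lambda>z. exp (- z * of_real (x\<^sup>2))) has_field_derivative - of_real (x\<^sup>2) * exp (- \<alpha> * of_real (x\<^sup>2))) (at \<alpha> within ?S)"
            by (auto intro!: derivative_eq_intros)
          then show "(\<lambda>i. ?q (X i) x) \<longlonglongrightarrow> - of_real (x\<^sup>2) * exp (- \<alpha> * of_real (x\<^sup>2))"
            using X unfolding has_field_derivative_iff tendsto_at_iff_sequentially comp_def by blast
        qed
        show "AE x in lborel. norm (?q (X i) x) \<le> x\<^sup>2 * exp (- c * x\<^sup>2)" for i
        proof (rule AE_I2)
          fix x :: real
          have "X i \<in> ?S" "X i \<noteq> \<alpha>" using X by auto
          then show "norm (?q (X i) x) \<le> x\<^sup>2 * exp (- c * x\<^sup>2)"
            using lip[of "X i" x] by (simp add: norm_divide divide_le_eq)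
        qed
      qed (auto intro!: borel_measurable_continuous_onI continuous_intros)
    qed
    then show ?thesis
      using at_within_open[of \<alpha> ?S] S c by auto
  qed
  \<comment> \<open>The quotient stays in the right half-plane, hence off the branch cut of
    \<open>Ln\<close>.\<close>
  have ndz: "of_real pi / z \<notin> \<real>\<^sub>\<le>\<^sub>0" if "Re z > 0" for z :: complex
  proof -
    have "Re (of_real pi / z) > 0"
      using that by (simp add: Re_divide_of_real Re_divide zero_less_divide_iff add_pos_nonneg)
    then show ?thesis using complex_nonpos_Reals_iff by force
  qed
  have "F \<alpha> - exp (Ln (of_real pi / \<alpha>) / 2) = 0"
  proof (rule analytic_continuation[where f = "\<lambda>z. F z - exp (Ln (of_real pi / z) / 2)" and w = \<alpha> and S = ?H and U = "of_real ` {0<..}" and \<xi> = 1])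
    have "F holomorphic_on ?H"
      by (rule holomorphic_onI) (use der field_differentiable_at_within field_differentiable_def in blast)
    then show "(\<lambda>z. F z - exp (Ln (of_real pi / z) / 2)) holomorphic_on ?H"
      by (auto intro!: holomorphic_intros ndz)
    show "open ?H" by (simp add: open_halfspace_Re_gt)
    show "connected ?H" by (simp add: convex_connected convex_halfspace_Re_gt)
    show "1 islimpt (of_real ` {0<..} :: complex set)"
      unfolding islimpt_approachable
    proof (intro allI impI)
      fix e :: real assume e: "e > 0"
      then have "complex_of_real (1 + e / 2) \<in> complex_of_real ` {0<..}"
        by (intro imageI) auto
      with e show "\<exists>x'\<in>complex_of_real ` {0<..}. x' \<noteq> 1 \<and> dist x' 1 < e"
        by (rule_tac x = "complex_of_real (1 + e / 2)" in bexI) (auto simp: dist_norm norm_divide)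
    qed
    fix z assume "z \<in> complex_of_real ` {0<..}"
    then obtain r where r: "z = of_real r" "r > 0" by auto
    have "F z = of_real (\<integral>(x::real). exp (- r * x\<^sup>2) \<partial>lborel)"
      unfolding F_def r(1) integral_complex_of_real[symmetric] exp_of_real[symmetric]
      by (simp del: integral_complex_of_real)
    also have "\<dots> = of_real (exp (ln (pi / r) / 2))"
      unfolding integral_gauss[OF r(2)] using r by (simp add: powr_half_sqrt[symmetric] powr_def)
    also have "\<dots> = exp (Ln (of_real pi / z) / 2)"
      using r Ln_of_real[of "pi / r"] by (simp flip: exp_of_real)
    finally show "F z - exp (Ln (of_real pi / z) / 2) = 0" by simp
  qed (use assms in auto)
  then show "(\<integral>(x::real). exp (- \<alpha> * of_real (x\<^sup>2)) \<partial>lborel) = exp (Ln (of_real pi / \<alpha>) / 2)"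
    by (simp add: F_def)
qed

lemma norm_sum_Basis_squared:
  "(norm (\<Sum>b\<in>(Basis::'a::euclidean_space set). f b *\<^sub>R b))\<^sup>2 = (\<Sum>b\<in>Basis. (f b)\<^sup>2)"
  unfolding power2_norm_eq_inner
  by (subst euclidean_inner) (auto intro!: sum.cong simp: power2_eq_square)

text \<open>Lebesgue measure is the image of a product measure and the Gaussian factors over the
  coordinates. The one-dimensional value is raised to an integer power, which just multiplies the
  exponent, so no question of branches arises.\<close>

lemma
  assumes "Re \<alpha> > 0"
  shows integrable_gauss_euclidean:
      "integrable lborel (\<lambda>x::'a::euclidean_space. exp (- \<alpha> * of_real ((norm x)\<^sup>2)))"
    and integral_gauss_euclidean:
      "(\<integral>(x::'a). exp (- \<alpha> * of_real ((norm x)\<^sup>2)) \<partial>lborel) = exp (of_nat DIM('a) / 2 * Ln (of_real pi / \<alpha>))"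
proof -
  interpret product_sigma_finite "\<lambda>b::'a. lborel :: real measure" ..
  let ?P = "\<Pi>\<^sub>M b\<in>(Basis::'a set). (lborel :: real measure)"
  let ?s = "\<lambda>f. \<Sum>b\<in>(Basis::'a set). f b *\<^sub>R b"
  have s: "?s \<in> ?P \<rightarrow>\<^sub>M borel" by measurable
  have g: "(\<lambda>x::'a. exp (- \<alpha> * of_real ((norm x)\<^sup>2))) \<in> borel_measurable borel"
    by (auto intro!: borel_measurable_continuous_onI continuous_intros)
  have e: "exp (- \<alpha> * of_real ((norm (?s f))\<^sup>2)) = (\<Prod>b\<in>Basis. exp (- \<alpha> * of_real ((f b)\<^sup>2)))" for f
    unfolding norm_sum_Basis_squared of_real_sum sum_distrib_left by (rule exp_sum[OF finite_Basis])
  have 1: "integrable ?P (\<lambda>f. \<Prod>b\<in>Basis. exp (- \<alpha> * of_real ((f b)\<^sup>2)))"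
    by (rule product_integrable_prod[OF finite_Basis integrable_gauss_complex[OF assms]])
  have 2: "(\<integral>f. (\<Prod>b\<in>Basis. exp (- \<alpha> * of_real ((f b)\<^sup>2))) \<partial>?P) = (\<Prod>b\<in>(Basis::'a set). exp (Ln (of_real pi / \<alpha>) / 2))"
    unfolding product_integral_prod[OF finite_Basis integrable_gauss_complex[OF assms]] integral_gauss_complex[OF assms] ..
  show "integrable lborel (\<lambda>x::'a::euclidean_space. exp (- \<alpha> * of_real ((norm x)\<^sup>2)))"
    unfolding lborel_eq[where 'a='a] integrable_distr_eq[OF s g] e by (rule 1)
  show "(\<integral>(x::'a). exp (- \<alpha> * of_real ((norm x)\<^sup>2)) \<partial>lborel) = exp (of_nat DIM('a) / 2 * Ln (of_real pi / \<alpha>))"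
    unfolding lborel_eq[where 'a='a] integral_distr[OF s g] e 2
    by (simp flip: exp_of_nat_mult)
qed

section \<open>Rigid motions and Lebesgue measure\<close>

lemma lborel_distr_minus:
  fixes c :: "'a::euclidean_space"
  shows "distr lborel borel (\<lambda>x. c - x) = lborel"
  by (subst (2) lborel_affine[of "-1" c]) (auto simp: density_1)

lemma nn_integral_lborel_plus:
  fixes f :: "'a::euclidean_space \<Rightarrow> ennreal"
  assumes [measurable]: "f \<in> borel_measurable borel"
  shows "(\<integral>\<^sup>+x. f (c + x) \<partial>lborel) = (\<integral>\<^sup>+x. f x \<partial>lborel)"
  using nn_integral_distr[of "(+) c" lborel borel f] by (simp add: lborel_distr_plus)

text \<open>For a Gaussian \<open>g\<close>, Fubini and translation invariance turn the product of \<open>\<integral>f(Tx)\<close> and \<open>\<integral>g\<close> into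
  \<open>\<integral>\<integral>f(y) g(y - Tx)\<close>, and \<open>g(y - Tx) = g(x - T\<inverse>y)\<close>; so \<open>f \<circ> T\<close> and \<open>f\<close> have the same integral.
  The library's change of variables only covers \<open>real ^ 'n\<close> with a well-ordered index type.\<close>

lemma lborel_distr_orthogonal:
  fixes T :: "'a::euclidean_space \<Rightarrow> 'a"
  assumes T: "orthogonal_transformation T"
  shows "distr lborel borel T = lborel"
proof -
  define U where "U = inv T"
  have lin: "linear T" and nT: "\<And>x. norm (T x) = norm x" and TU: "\<And>y. T (U y) = y"
    using T orthogonal_transformation_surj[OF T]
    by (auto simp: orthogonal_transformation_linear orthogonal_transformation_norm U_def surj_f_inv_f)
  have [measurable]: "T \<in> borel_measurable borel"
    using lin by (intro borel_measurable_continuous_onI linear_continuous_on) (simp add: linear_conv_bounded_linear)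
  define g :: "'a \<Rightarrow> ennreal" where "g = (\<lambda>y. ennreal (exp (- (norm y)\<^sup>2)))"
  have [measurable]: "g \<in> borel_measurable borel"
    unfolding g_def by measurable
  \<comment> \<open>The factor to be cancelled at the end; this is why it is shown to be finite and
    nonzero.\<close>
  define I where "I = (\<integral>\<^sup>+y. g y \<partial>lborel)"
  have "integrable lborel (\<lambda>x::'a. exp (- 1 * complex_of_real ((norm x)\<^sup>2)))"
    by (rule integrable_gauss_euclidean) simp
  then have "I < \<infinity>"
    unfolding integrable_iff_bounded I_def g_def by (simp add: norm_exp_eq_Re)
  moreover have "I \<noteq> 0"
  proof
    assume "I = 0"
    then have "AE x::'a in lborel. False"
      unfolding I_def by (subst (asm) nn_integral_0_iff_AE) (auto simp: g_def)
    then show False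
      using ae_filter_eq_bot_iff[of "lborel :: 'a measure"] by (simp add: trivial_limit_def)
  qed
  ultimately have I: "I \<noteq> 0" "I \<noteq> \<infinity>" by auto
  have main: "(\<integral>\<^sup>+x. f (T x) \<partial>lborel) = (\<integral>\<^sup>+x. f x \<partial>lborel)"
    if [measurable]: "f \<in> borel_measurable borel" for f :: "'a \<Rightarrow> ennreal"
  proof -
    have "(\<integral>\<^sup>+x. f (T x) \<partial>lborel) * I = (\<integral>\<^sup>+y. (\<integral>\<^sup>+x. f (T x) \<partial>lborel) * g y \<partial>lborel)"
      unfolding I_def by (simp add: nn_integral_cmult)
    also have "\<dots> = (\<integral>\<^sup>+y. (\<integral>\<^sup>+x. f (y + T x) * g y \<partial>lborel) \<partial>lborel)"
    proof (rule nn_integral_cong)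
      fix y :: 'a
      have "(\<integral>\<^sup>+x. f (T x) \<partial>lborel) = (\<integral>\<^sup>+x. f (T (U y + x)) \<partial>lborel)"
        by (rule nn_integral_lborel_plus[symmetric]) simp
      then show "(\<integral>\<^sup>+x. f (T x) \<partial>lborel) * g y = (\<integral>\<^sup>+x. f (y + T x) * g y \<partial>lborel)"
        by (simp add: linear_add[OF lin] TU nn_integral_multc)
    qed
    also have "\<dots> = (\<integral>\<^sup>+x. (\<integral>\<^sup>+y. f (y + T x) * g y \<partial>lborel) \<partial>lborel)"
      by (rule lborel_pair.Fubini') simp
    also have "\<dots> = (\<integral>\<^sup>+x. (\<integral>\<^sup>+y. f y * g (y - T x) \<partial>lborel) \<partial>lborel)"
    proof (rule nn_integral_cong)
      fix x :: 'a
      show "(\<integral>\<^sup>+y. f (y + T x) * g y \<partial>lborel) = (\<integral>\<^sup>+y. f y * g (y - T x) \<partial>lborel)"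
        using nn_integral_lborel_plus[of "\<lambda>y. f y * g (y - T x)" "T x"] by (simp add: add.commute)
    qed
    also have "\<dots> = (\<integral>\<^sup>+y. (\<integral>\<^sup>+x. f y * g (y - T x) \<partial>lborel) \<partial>lborel)"
      by (rule lborel_pair.Fubini'[symmetric]) simp
    also have "\<dots> = (\<integral>\<^sup>+y. f y * I \<partial>lborel)"
    proof (rule nn_integral_cong)
      fix y :: 'a
      have "g (y - T x) = g (- U y + x)" for x
        using nT[of "U y - x"] by (simp add: g_def linear_diff[OF lin] TU norm_minus_commute)
      then show "(\<integral>\<^sup>+x. f y * g (y - T x) \<partial>lborel) = f y * I"
        using nn_integral_lborel_plus[of g "- U y"] by (simp add: nn_integral_cmult I_def)
    qed
    also have "\<dots> = (\<integral>\<^sup>+x. f x \<partial>lborel) * I"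
      by (simp add: nn_integral_multc)
    finally show ?thesis
      using I by (metis ennreal_mult_divide_eq infinity_ennreal_def)
  qed
  show ?thesis
  proof (rule measure_eqI)
    fix A assume "A \<in> sets (distr lborel borel T)"
    then have A[measurable]: "A \<in> sets borel" by simp
    have "emeasure (distr lborel borel T) A = (\<integral>\<^sup>+x. indicator A (T x) \<partial>lborel)"
      using nn_integral_distr[of T lborel borel "indicator A"] by simp
    also have "\<dots> = emeasure lborel A"
      by (subst main) auto
    finally show "emeasure (distr lborel borel T) A = emeasure lborel A" .
  qed simp
qed

lemma
  fixes f :: "'a::euclidean_space \<Rightarrow> 'b::{banach, second_countable_topology}"
  assumes f[measurable]: "f \<in> borel_measurable borel"
  shows integral_lborel_plus: "(\<integral>x. f (c + x) \<partial>lborel) = (\<integral>x. f x \<partial>lborel)"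
    and integral_lborel_minus: "(\<integral>x. f (c - x) \<partial>lborel) = (\<integral>x. f x \<partial>lborel)"
    and integrable_lborel_minus: "integrable lborel (\<lambda>x. f (c - x)) \<longleftrightarrow> integrable lborel f"
  using integral_distr[of "(+) c" lborel borel f]
    integral_distr[of "(-) c" lborel borel f] integrable_distr_eq[of "(-) c" lborel borel f]
  by (simp_all add: lborel_distr_plus lborel_distr_minus)

lemma integral_lborel_orthogonal:
  fixes f :: "'a::euclidean_space \<Rightarrow> 'b::{banach, second_countable_topology}"
  assumes [measurable]: "f \<in> borel_measurable borel" and T: "orthogonal_transformation (T :: 'a \<Rightarrow> 'a)"
  shows "(\<integral>x. f (T x) \<partial>lborel) = (\<integral>x. f x \<partial>lborel)"
proof -
  have "T \<in> borel_measurable borel"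
    using orthogonal_transformation_linear[OF T]
    by (intro borel_measurable_continuous_onI linear_continuous_on) (simp add: linear_conv_bounded_linear)
  then show ?thesis
    using integral_distr[of T lborel borel f] by (simp add: lborel_distr_orthogonal[OF T])
qed

section \<open>Convolution with bounded functions\<close>

definition conv :: "('a::euclidean_space \<Rightarrow> complex) \<Rightarrow> ('a \<Rightarrow> complex) \<Rightarrow> 'a \<Rightarrow> complex" where
  "conv g f x = (\<integral>\<xi>. g (x - \<xi>) * f \<xi> \<partial>lborel)"

context
  fixes g :: "'a::euclidean_space \<Rightarrow> complex"
  assumes g: "integrable lborel g"
begin

lemma borel_measurable_kernel[measurable]: "g \<in> borel_measurable borel"
  using g by auto

lemma integrable_conv:
  assumes [measurable]: "f \<in> borel_measurable borel" and K: "\<And>x. norm (f x) \<le> K"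
  shows "integrable lborel (\<lambda>\<xi>. g (x - \<xi>) * f \<xi>)"
proof (rule Bochner_Integration.integrable_bound)
  show "integrable lborel (\<lambda>\<xi>. K *\<^sub>R g (x - \<xi>))"
    using g by (simp add: integrable_lborel_minus)
  show "AE \<xi> in lborel. norm (g (x - \<xi>) * f \<xi>) \<le> norm (K *\<^sub>R g (x - \<xi>))"
    using K by (auto simp: norm_mult mult.commute intro!: mult_right_mono order_trans[OF K])
qed simp

lemma norm_conv_le:
  assumes [measurable]: "f \<in> borel_measurable borel" and K: "\<And>x. norm (f x) \<le> K"
  shows "norm (conv g f x) \<le> K * (\<integral>\<xi>. norm (g \<xi>) \<partial>lborel)"
proof -
  have "norm (conv g f x) \<le> (\<integral>\<xi>. K * norm (g (x - \<xi>)) \<partial>lborel)"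
    unfolding conv_def
  proof (rule Bochner_Integration.integral_norm_bound_integral)
    show "integrable lborel (\<lambda>\<xi>. g (x - \<xi>) * f \<xi>)"
      by (rule integrable_conv) fact+
    show "integrable lborel (\<lambda>\<xi>. K * norm (g (x - \<xi>)))"
      using g by (auto simp: integrable_lborel_minus)
    show "norm (g (x - \<xi>) * f \<xi>) \<le> K * norm (g (x - \<xi>))" for \<xi>
      using K by (auto simp: norm_mult mult.commute intro!: mult_right_mono)
  qed
  also have "\<dots> = K * (\<integral>\<xi>. norm (g \<xi>) \<partial>lborel)"
    by (simp add: integral_lborel_minus[where f = "\<lambda>\<xi>. norm (g \<xi>)"])
  finally show ?thesis .
qed

lemma conv_linear:
  assumes [measurable]: "f \<in> borel_measurable borel" and K: "\<And>x. norm (f x) \<le> K"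
    and [measurable]: "h \<in> borel_measurable borel" and L: "\<And>x. norm (h x) \<le> L"
  shows "conv g (\<lambda>x. c * f x + h x) x = c * conv g f x + conv g h x"
proof -
  have *: "integrable lborel (\<lambda>\<xi>. g (x - \<xi>) * f \<xi>)" "integrable lborel (\<lambda>\<xi>. g (x - \<xi>) * h \<xi>)"
    by (rule integrable_conv, fact+)+
  have "conv g (\<lambda>x. c * f x + h x) x = (\<integral>\<xi>. c * (g (x - \<xi>) * f \<xi>) + g (x - \<xi>) * h \<xi> \<partial>lborel)"
    unfolding conv_def by (simp add: algebra_simps)
  also have "\<dots> = c * conv g f x + conv g h x"
    unfolding conv_def using * by simp
  finally show ?thesis .
qed

text \<open>Moving the base point to 0 turns the difference of two values of \<open>conv g f\<close>
  into a single convolution of an increment of \<open>f\<close>.\<close>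

lemma conv_translate:
  assumes [measurable]: "f \<in> borel_measurable borel"
  shows "conv g f x = conv g (\<lambda>\<xi>. f (x + \<xi>)) 0"
  unfolding conv_def using integral_lborel_plus[of "\<lambda>\<xi>. g (x - \<xi>) * f \<xi>" x] by simp

text \<open>A radial kernel sees only the distance of its two points, which \<open>T\<close>
  preserves; substituting \<open>T \<xi>\<close> for \<xi> leaves the integral unchanged.\<close>

lemma conv_orthogonal:
  assumes [measurable]: "f \<in> borel_measurable borel" and T: "orthogonal_transformation (T :: 'a \<Rightarrow> 'a)"
    and radial: "\<And>x y. norm x = norm y \<Longrightarrow> g x = g y"
  shows "conv g (\<lambda>x. f (T x)) x = conv g f (T x)"
proof -
  have "g (x - \<xi>) = g (T x - T \<xi>)" for \<xi>
    using orthogonal_transformation_norm[OF T, of "x - \<xi>"]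
    by (intro radial) (simp add: linear_diff[OF orthogonal_transformation_linear[OF T]])
  then show ?thesis
    unfolding conv_def
    using integral_lborel_orthogonal[of "\<lambda>\<xi>. g (T x - \<xi>) * f \<xi>" T] T by simp
qed

lemma conv_diff_le:
  assumes f[measurable]: "f \<in> borel_measurable borel" and K: "\<And>x. norm (f x) \<le> K"
    and e: "\<And>\<xi>. norm (f (x + \<xi>) - f (y + \<xi>)) \<le> e"
  shows "norm (conv g f x - conv g f y) \<le> e * (\<integral>\<xi>. norm (g \<xi>) \<partial>lborel)"
proof -
  have "conv g f x - conv g f y = conv g (\<lambda>\<xi>. (- 1) * f (y + \<xi>) + f (x + \<xi>)) 0"
    by (subst conv_linear[where K = K and L = K]) (auto simp: conv_translate[OF f] K)
  also have "norm \<dots> \<le> e * (\<integral>\<xi>. norm (g \<xi>) \<partial>lborel)"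
    by (rule norm_conv_le) (use e in auto)
  finally show ?thesis .
qed

text \<open>Since \<open>g\<close> has integral 1, \<open>f x\<close> equals the integral of
  \<open>g (x - \<xi>) * f x\<close>, and the bound on \<open>f \<xi> - f x\<close> can be
  integrated against \<open>norm (g (x - \<xi>))\<close>. The quadratic term becomes a second
  moment, which for the heat kernel is small at small times.\<close>

lemma conv_diff_at_le:
  assumes f[measurable]: "f \<in> borel_measurable borel" and K: "\<And>x. norm (f x) \<le> K"
    and one: "(\<integral>\<xi>. g \<xi> \<partial>lborel) = 1"
    and g2: "integrable lborel (\<lambda>\<xi>. (norm \<xi>)\<^sup>2 * norm (g \<xi>))"
    and e: "\<And>y. norm (f y - f x) \<le> e + L * (norm (y - x))\<^sup>2"
  shows "norm (conv g f x - f x) \<le> e * (\<integral>\<xi>. norm (g \<xi>) \<partial>lborel) + L * (\<integral>\<xi>. (norm \<xi>)\<^sup>2 * norm (g \<xi>) \<partial>lborel)"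
proof -
  have "conv g f x - f x = (\<integral>\<xi>. g (x - \<xi>) * f \<xi> \<partial>lborel) - (\<integral>\<xi>. g (x - \<xi>) * f x \<partial>lborel)"
    using one by (simp add: conv_def integral_lborel_minus)
  also have "\<dots> = (\<integral>\<xi>. g (x - \<xi>) * (f \<xi> - f x) \<partial>lborel)"
    using g integrable_conv[OF f K]
    by (subst Bochner_Integration.integral_diff[symmetric]) (auto simp: integrable_lborel_minus right_diff_distrib)
  also have "norm \<dots> \<le> (\<integral>\<xi>. e * norm (g (x - \<xi>)) + L * ((norm (x - \<xi>))\<^sup>2 * norm (g (x - \<xi>))) \<partial>lborel)"
  proof (rule Bochner_Integration.integral_norm_bound_integral)
    have "norm (f y - f x) \<le> K + K" for y
      using K[of x] K[of y] norm_triangle_ineq4[of "f y" "f x"] by linarith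
    then show "integrable lborel (\<lambda>\<xi>. g (x - \<xi>) * (f \<xi> - f x))"
      by (intro integrable_conv) auto
    show "integrable lborel (\<lambda>\<xi>. e * norm (g (x - \<xi>)) + L * ((norm (x - \<xi>))\<^sup>2 * norm (g (x - \<xi>))))"
      using g g2 integrable_lborel_minus[of "\<lambda>\<xi>. (norm \<xi>)\<^sup>2 * norm (g \<xi>)" x]
      by (auto simp: integrable_lborel_minus intro!: Bochner_Integration.integrable_add)
    show "norm (g (x - \<xi>) * (f \<xi> - f x)) \<le> e * norm (g (x - \<xi>)) + L * ((norm (x - \<xi>))\<^sup>2 * norm (g (x - \<xi>)))" for \<xi>
      using mult_left_mono[OF e[of \<xi>], of "norm (g (x - \<xi>))"]
      unfolding norm_mult by (simp add: distrib_left ac_simps norm_minus_commute)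
  qed
  also have "\<dots> = (\<integral>\<xi>. e * norm (g \<xi>) + L * ((norm \<xi>)\<^sup>2 * norm (g \<xi>)) \<partial>lborel)"
    by (rule integral_lborel_minus) simp
  also have "\<dots> = e * (\<integral>\<xi>. norm (g \<xi>) \<partial>lborel) + L * (\<integral>\<xi>. (norm \<xi>)\<^sup>2 * norm (g \<xi>) \<partial>lborel)"
    using g g2 by (subst Bochner_Integration.integral_add) auto
  finally show ?thesis .
qed

end

lemma borel_measurable_conv:
  assumes [measurable]: "g \<in> borel_measurable borel" "f \<in> borel_measurable borel"
  shows "conv g f \<in> borel_measurable borel"
  unfolding conv_def[abs_def] by measurable

text \<open>Fubini. The double integrand is absolutely integrable because its inner integral is at
  most K times the L^1 norm of \<open>h\<close> times \<open>norm (g (x - \<eta>))\<close>.\<close>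

lemma conv_assoc:
  fixes g h :: "'a::euclidean_space \<Rightarrow> complex"
  assumes g: "integrable lborel g" and h: "integrable lborel h"
    and f[measurable]: "f \<in> borel_measurable borel" and K: "\<And>x. norm (f x) \<le> K"
  shows "conv g (conv h f) x = conv (conv g h) f x"
proof -
  have [measurable]: "g \<in> borel_measurable borel" "h \<in> borel_measurable borel"
    using g h by auto
  let ?F = "\<lambda>\<eta> \<xi>. g (x - \<eta>) * (h (\<eta> - \<xi>) * f \<xi>)"
  have F: "integrable (lborel \<Otimes>\<^sub>M lborel) (\<lambda>(\<eta>, \<xi>). ?F \<eta> \<xi>)"
  proof (rule lborel_pair.Fubini_integrable)
    show "integrable lborel (\<lambda>\<eta>. \<integral>\<xi>. norm (case (\<eta>, \<xi>) of (\<eta>, \<xi>) \<Rightarrow> ?F \<eta> \<xi>) \<partial>lborel)"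
    proof (rule Bochner_Integration.integrable_bound)
      show "integrable lborel (\<lambda>\<eta>. (K * (\<integral>\<xi>. norm (h \<xi>) \<partial>lborel)) *\<^sub>R g (x - \<eta>))"
        using g by (simp add: integrable_lborel_minus)
      show "AE \<eta> in lborel. norm (\<integral>\<xi>. norm (case (\<eta>, \<xi>) of (\<eta>, \<xi>) \<Rightarrow> ?F \<eta> \<xi>) \<partial>lborel)
          \<le> norm ((K * (\<integral>\<xi>. norm (h \<xi>) \<partial>lborel)) *\<^sub>R g (x - \<eta>))"
      proof (rule AE_I2)
        fix \<eta> :: 'a
        have int: "integrable lborel (\<lambda>\<xi>. norm (h (\<eta> - \<xi>) * f \<xi>))"
          by (rule integrable_norm[OF integrable_conv[OF h f K]])
        have le: "(\<integral>\<xi>. norm (h (\<eta> - \<xi>) * f \<xi>) \<partial>lborel) \<le> K * (\<integral>\<xi>. norm (h \<xi>) \<partial>lborel)"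
        proof -
          have "(\<integral>\<xi>. norm (h (\<eta> - \<xi>) * f \<xi>) \<partial>lborel) \<le> (\<integral>\<xi>. K * norm (h (\<eta> - \<xi>)) \<partial>lborel)"
            using h int K by (intro integral_mono)
              (auto simp: integrable_lborel_minus norm_mult mult.commute[of K] intro!: mult_left_mono)
          then show ?thesis
            by (simp add: integral_lborel_minus[where f = "\<lambda>\<xi>. norm (h \<xi>)"])
        qed
        have "norm (\<integral>\<xi>. norm (?F \<eta> \<xi>) \<partial>lborel) = norm (g (x - \<eta>)) * (\<integral>\<xi>. norm (h (\<eta> - \<xi>) * f \<xi>) \<partial>lborel)"
          by (simp add: norm_mult[of "g _"] integral_nonneg_AE)
        also have "\<dots> \<le> norm (g (x - \<eta>)) * (K * (\<integral>\<xi>. norm (h \<xi>) \<partial>lborel))"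
          by (intro mult_left_mono le) simp
        also have "\<dots> \<le> norm ((K * (\<integral>\<xi>. norm (h \<xi>) \<partial>lborel)) *\<^sub>R g (x - \<eta>))"
          by (simp add: mult.commute) (intro mult_left_mono abs_ge_self norm_ge_zero)
        finally show "norm (\<integral>\<xi>. norm (case (\<eta>, \<xi>) of (\<eta>, \<xi>) \<Rightarrow> ?F \<eta> \<xi>) \<partial>lborel)
          \<le> norm ((K * (\<integral>\<xi>. norm (h \<xi>) \<partial>lborel)) *\<^sub>R g (x - \<eta>))" by simp
      qed
    qed measurable
    show "AE \<eta> in lborel. integrable lborel (\<lambda>\<xi>. case (\<eta>, \<xi>) of (\<eta>, \<xi>) \<Rightarrow> ?F \<eta> \<xi>)"
      using integrable_conv[OF h f K] by simp
  qed measurable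
  have "conv g (conv h f) x = (\<integral>\<eta>. (\<integral>\<xi>. ?F \<eta> \<xi> \<partial>lborel) \<partial>lborel)"
    unfolding conv_def by simp
  also have "\<dots> = (\<integral>\<xi>. (\<integral>\<eta>. ?F \<eta> \<xi> \<partial>lborel) \<partial>lborel)"
    by (rule lborel_pair.Fubini_integral[symmetric]) (rule F)
  also have "\<dots> = (\<integral>\<xi>. (\<integral>\<eta>. g (x - \<eta>) * h (\<eta> - \<xi>) \<partial>lborel) * f \<xi> \<partial>lborel)"
    by (simp flip: mult.assoc)
  also have "\<dots> = conv (conv g h) f x"
  proof -
    \<comment> \<open>Substitute \<open>\<xi> + \<eta>\<close> for \<eta>.\<close>
    have "(\<integral>\<eta>. g (x - \<eta>) * h (\<eta> - \<xi>) \<partial>lborel) = conv g h (x - \<xi>)" for \<xi>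
      using integral_lborel_plus[of "\<lambda>\<eta>. g (x - \<eta>) * h (\<eta> - \<xi>)" \<xi>]
      by (simp add: conv_def algebra_simps)
    then show ?thesis by (simp add: conv_def[of "conv g h"])
  qed
  finally show ?thesis .
qed

section \<open>The heat kernel with complex diffusion coefficient\<close>

text \<open>The first factor is \<open>4 * pi * z\<close> to the power -d/2 on the principal branch,
  in the form in which \<open>mat_cpow\<close> acts on an eigenvalue.\<close>

definition heat :: "complex \<Rightarrow> 'a::euclidean_space \<Rightarrow> complex" where
  "heat z x = exp (- (of_nat DIM('a) / 2) * Ln (of_real (4 * pi) * z)) * exp (- (1 / (4 * z)) * of_real ((norm x)\<^sup>2))"

lemma heat_cong_norm: "norm x = norm y \<Longrightarrow> heat z x = heat z y" for x y :: "'a::euclidean_space"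
  by (simp add: heat_def)

lemma Re_inverse_pos: "Re z > 0 \<Longrightarrow> Re (1 / (4 * z)) > 0"
  by (simp add: Re_divide zero_less_divide_iff power2_eq_square add_pos_nonneg)

text \<open>For the rate \<open>1 / (4 * z)\<close> the Gaussian integral involves \<open>Ln\<close>
  of the same number \<open>4 * pi * z\<close> as the prefactor, with the opposite coefficient, so
  the two exponentials cancel exactly.\<close>

lemma
  assumes "Re z > 0"
  shows integrable_heat: "integrable lborel (heat z :: 'a::euclidean_space \<Rightarrow> complex)"
    and integral_heat: "(\<integral>(x::'a). heat z x \<partial>lborel) = 1"
proof -
  note R = Re_inverse_pos[OF assms]
  show "integrable lborel (heat z :: 'a \<Rightarrow> complex)"
    unfolding heat_def[abs_def] by (intro integrable_mult_right integrable_gauss_euclidean R)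
  have "z \<noteq> 0" using assms by auto
  have "(\<integral>(x::'a). heat z x \<partial>lborel) = exp (- (of_nat DIM('a) / 2) * Ln (of_real (4 * pi) * z)) *
      exp (of_nat DIM('a) / 2 * Ln (of_real pi / (1 / (4 * z))))"
    unfolding heat_def integral_mult_right_zero integral_gauss_euclidean[OF R] ..
  also have "\<dots> = 1"
    by (simp add: mult_ac flip: exp_add)
  finally show "(\<integral>(x::'a). heat z x \<partial>lborel) = 1" .
qed

lemma integral_gauss_euclidean_real:
  assumes c: "(c::real) > 0"
  shows "integrable lborel (\<lambda>x::'a::euclidean_space. exp (- c * (norm x)\<^sup>2))"
    and "(\<integral>(x::'a). exp (- c * (norm x)\<^sup>2) \<partial>lborel) = (pi / c) powr (real DIM('a) / 2)"
proof -
  have e: "exp (- of_real c * of_real ((norm x)\<^sup>2)) = complex_of_real (exp (- c * (norm x)\<^sup>2))" for x :: 'a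
    by (simp flip: exp_of_real)
  have Rc: "Re (of_real c) > 0" using c by simp
  show "integrable lborel (\<lambda>x::'a::euclidean_space. exp (- c * (norm x)\<^sup>2))"
    using integrable_gauss_euclidean[OF Rc, where 'a='a] unfolding e by (simp only: complex_of_real_integrable_eq)
  have L: "Ln (of_real pi / of_real c) = of_real (ln (pi / c))"
    using c Ln_of_real[of "pi / c"] by simp
  have "complex_of_real (\<integral>(x::'a). exp (- c * (norm x)\<^sup>2) \<partial>lborel) = of_real (exp (DIM('a) / 2 * ln (pi / c)))"
    using integral_gauss_euclidean[OF Rc, where 'a='a] unfolding e L integral_complex_of_real
    by (simp flip: exp_of_real)
  then show "(\<integral>(x::'a). exp (- c * (norm x)\<^sup>2) \<partial>lborel) = (pi / c) powr (real DIM('a) / 2)"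
    using c unfolding of_real_eq_iff by (simp add: powr_def)
qed

text \<open>Imaginary parts in the exponents contribute only phases; what remains is a real Gaussian
  of rate \<open>Re (1 / (4 * z))\<close>.\<close>

lemma norm_heat:
  fixes x :: "'a::euclidean_space"
  assumes z: "Re z > 0"
  shows "norm (heat z x) = (4 * pi * norm z) powr - (DIM('a) / 2) * exp (- (Re z / (4 * (norm z)\<^sup>2)) * (norm x)\<^sup>2)"
proof -
  have "z \<noteq> 0" using z by auto
  have "norm (exp (- (of_nat DIM('a) / 2) * Ln (of_real (4 * pi) * z))) = exp (- (real DIM('a) / 2) * ln (4 * pi * norm z))"
    using \<open>z \<noteq> 0\<close> by (simp add: norm_exp_eq_Re norm_mult)
  also have "\<dots> = (4 * pi * norm z) powr - (DIM('a) / 2)"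
    using \<open>z \<noteq> 0\<close> by (simp add: powr_def)
  moreover have "Re (1 / (4 * z)) = Re z / (4 * (norm z)\<^sup>2)"
  proof -
    have "(Re (4 * z))\<^sup>2 + (Im (4 * z))\<^sup>2 = 16 * (norm z)\<^sup>2"
      by (simp add: cmod_power2 power_mult_distrib)
    then show ?thesis by (simp add: Re_divide)
  qed
  moreover have "norm (exp (- k * of_real y)) = exp (- Re k * y)" for k y
    by (simp add: norm_exp_eq_Re)
  ultimately show ?thesis
    unfolding heat_def norm_mult by presburger
qed

text \<open>The L^1 norm of \<open>heat (of_real t * a)\<close> in dimension d, the same for every
  \<open>t > 0\<close>.\<close>

definition heat_mass :: "nat \<Rightarrow> complex \<Rightarrow> real" where
  "heat_mass d a = (norm a / Re a) powr (real d / 2)"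

lemma heat_mass_pos: "Re a > 0 \<Longrightarrow> heat_mass d a > 0"
  by (auto simp: heat_mass_def)

text \<open>By \<open>norm_heat\<close> everything is a real Gaussian integral of rate
  \<open>c\<close>. In the mass the factor t cancels, because only the ratio of
  \<open>norm z\<close> to \<open>Re z\<close> enters; the second moment keeps one factor
  \<open>1 / c\<close>, which is proportional to t.\<close>

lemma
  assumes a: "Re a > 0" and t: "t > 0"
  shows integral_norm_heat:
      "(\<integral>(x::'a::euclidean_space). norm (heat (of_real t * a) x) \<partial>lborel) = heat_mass DIM('a) a"
    and integrable_heat_moment2: "integrable lborel (\<lambda>x::'a. (norm x)\<^sup>2 * norm (heat (of_real t * a) x))"
    and integral_heat_moment2:
      "(\<integral>(x::'a). (norm x)\<^sup>2 * norm (heat (of_real t * a) x) \<partial>lborel)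
         \<le> t * (8 * (norm a)\<^sup>2 / Re a * 2 powr (real DIM('a) / 2) * heat_mass DIM('a) a)"
proof -
  define z where "z = of_real t * a"
  define p where "p = real DIM('a) / 2"
  define c where "c = Re z / (4 * (norm z)\<^sup>2)"
  have z: "Re z > 0" "z \<noteq> 0" using a t by (auto simp: z_def)
  have a0: "a \<noteq> 0" using a by auto
  have c: "c > 0" using z by (auto simp: c_def)
  have powr_quot: "x powr - p * y powr p = (y / x) powr p" if "x > 0" "y > 0" for x y :: real
    using that by (simp add: powr_divide powr_minus_divide)
  \<comment> \<open>Used with \<open>k = 1\<close> for the mass and with \<open>k = 2\<close> for
    the halved rate in the second moment.\<close>
  have p: "(4 * pi * norm z) powr - p * (pi / (c / k)) powr p = k powr p * heat_mass DIM('a) a" if "k > 0" for k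
  proof -
    have "pi / (c / k) / (4 * pi * norm z) = k * (norm a / Re a)"
      using z a t a0 by (simp add: c_def z_def norm_mult field_simps power2_eq_square)
    then have "(4 * pi * norm z) powr - p * (pi / (c / k)) powr p = (k * (norm a / Re a)) powr p"
      using z c that powr_quot[of "4 * pi * norm z" "pi / (c / k)"] by simp
    also have "\<dots> = k powr p * heat_mass DIM('a) a"
      using that a by (simp only: powr_mult heat_mass_def p_def)
    finally show ?thesis .
  qed
  note norm_z = norm_heat[OF z(1), where 'a='a, folded c_def p_def]
  show "(\<integral>(x::'a). norm (heat (of_real t * a) x) \<partial>lborel) = heat_mass DIM('a) a"
    unfolding z_def[symmetric] norm_z using p[of 1] integral_gauss_euclidean_real(2)[OF c, where 'a='a]
    by (simp add: p_def)
  \<comment> \<open>Half of the decay absorbs the factor |x|^2, since y is at most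
    \<open>exp y\<close> for \<open>y = c / 2 * (norm x)\<^sup>2\<close>; a Gaussian of rate
    \<open>c / 2\<close> remains.\<close>
  let ?G = "\<lambda>x::'a. (4 * pi * norm z) powr - p * (2 / c * exp (- (c / 2) * (norm x)\<^sup>2))"
  have G: "integrable lborel ?G"
    using c by (intro integrable_mult_right integral_gauss_euclidean_real) auto
  have le: "(norm x)\<^sup>2 * norm (heat z x) \<le> ?G x" for x :: 'a
  proof -
    have "(c / 2) * (norm x)\<^sup>2 \<le> exp (c / 2 * (norm x)\<^sup>2)"
      using exp_ge_add_one_self[of "c / 2 * (norm x)\<^sup>2"] by linarith
    then have "(norm x)\<^sup>2 \<le> 2 / c * exp (c / 2 * (norm x)\<^sup>2)"
      using c by (simp add: field_simps)
    then have "(norm x)\<^sup>2 * exp (- c * (norm x)\<^sup>2) \<le> 2 / c * exp (c / 2 * (norm x)\<^sup>2) * exp (- c * (norm x)\<^sup>2)"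
      by (rule mult_right_mono) simp
    also have "\<dots> = 2 / c * exp (- (c / 2) * (norm x)\<^sup>2)"
      by (simp add: field_simps flip: exp_add)
    finally show ?thesis
      unfolding norm_z mult.left_commute[of "(norm x)\<^sup>2" "(4 * pi * norm z) powr - p"]
      by (rule mult_left_mono) simp
  qed
  show int: "integrable lborel (\<lambda>x::'a. (norm x)\<^sup>2 * norm (heat (of_real t * a) x))"
    unfolding z_def[symmetric]
  proof (rule Bochner_Integration.integrable_bound[OF G])
    have [measurable]: "(heat z :: 'a \<Rightarrow> complex) \<in> borel_measurable borel"
      using borel_measurable_integrable[OF integrable_heat[OF z(1), where 'a='a]] by simp
    show "(\<lambda>x::'a. (norm x)\<^sup>2 * norm (heat z x)) \<in> borel_measurable lborel"
      by measurable
    show "AE x::'a in lborel. norm ((norm x)\<^sup>2 * norm (heat z x)) \<le> norm (?G x)"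
      using le c by (intro AE_I2) (simp add: abs_mult)
  qed
  have "(\<integral>(x::'a). (norm x)\<^sup>2 * norm (heat (of_real t * a) x) \<partial>lborel) \<le> (\<integral>(x::'a). ?G x \<partial>lborel)"
    using G int le by (intro integral_mono) (auto simp: z_def)
  also have "\<dots> = 2 / c * ((4 * pi * norm z) powr - p * (pi / (c / 2)) powr p)"
    unfolding integral_mult_right_zero
    using integral_gauss_euclidean_real(2)[of "c / 2", where 'a='a] c by (simp add: p_def)
  also have "\<dots> = 2 / c * (2 powr p * heat_mass DIM('a) a)"
    using p[of 2] by simp
  also have "2 / c = t * (8 * (norm a)\<^sup>2 / Re a)"
    using t a by (simp add: c_def z_def norm_mult power2_eq_square field_simps)
  finally show "(\<integral>(x::'a). (norm x)\<^sup>2 * norm (heat (of_real t * a) x) \<partial>lborel)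
         \<le> t * (8 * (norm a)\<^sup>2 / Re a * 2 powr (real DIM('a) / 2) * heat_mass DIM('a) a)"
    by (simp add: p_def mult.assoc)
qed

text \<open>Completing the square: the kernels at times \<open>s\<close> and \<open>t\<close> have the same coefficient \<open>a\<close>, so the
  Gaussian in \<open>\<eta>\<close> is centred at the real point \<open>(t / (s + t)) w\<close>, and no contour shift is needed.\<close>

lemma conv_heat:
  fixes w :: "'a::euclidean_space"
  assumes a: "Re a > 0" and s: "s > 0" and t: "t > 0"
  shows "conv (heat (of_real s * a)) (heat (of_real t * a)) w = heat (of_real (s + t) * a) w"
proof -
  \<comment> \<open>\<open>1 / r = 1 / s + 1 / t\<close>, so \<open>r\<close> is the time parameter
    of the Gaussian in \<eta> left after completing the square; \<open>s * t = (s + t) * r\<close>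
    balances the prefactors.\<close>
  define r where "r = s * t / (s + t)"
  have st: "s + t > 0" "r > 0" using s t by (auto simp: r_def)
  have a0: "a \<noteq> 0" using a by auto
  define m where "m = (t / (s + t)) *\<^sub>R w"
  have sq: "(norm (w - \<eta>))\<^sup>2 / s + (norm \<eta>)\<^sup>2 / t = (norm w)\<^sup>2 / (s + t) + (norm (- m + \<eta>))\<^sup>2 / r" for \<eta> :: 'a
  proof -
    have 1: "(norm (w - \<eta>))\<^sup>2 = w \<bullet> w - 2 * (w \<bullet> \<eta>) + \<eta> \<bullet> \<eta>"
      unfolding power2_norm_eq_inner by (simp add: inner_diff inner_commute algebra_simps)
    have 2: "(norm (- m + \<eta>))\<^sup>2 = (t / (s + t))\<^sup>2 * (w \<bullet> w) - 2 * (t / (s + t)) * (w \<bullet> \<eta>) + \<eta> \<bullet> \<eta>"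
      unfolding power2_norm_eq_inner m_def
      by (simp add: inner_add inner_diff inner_commute algebra_simps power2_eq_square)
    show ?thesis
      unfolding 1 2 unfolding r_def power2_norm_eq_inner using s t st(1)
      by (simp add: divide_simps power2_eq_square) (simp add: algebra_simps)
  qed
  \<comment> \<open>A positive real factor splits off \<open>Ln\<close> without a multiple of
    \<open>2 * pi * \<i>\<close>, so the prefactors reduce to an identity of real
    logarithms.\<close>
  have Lf: "Ln (of_real (4 * pi) * (of_real u * a)) = of_real (ln (4 * pi * u)) + Ln a" if "u > 0" for u
    using that a0 Ln_times_of_real[of "4 * pi * u" a] Ln_of_real[of "4 * pi * u"] by (simp add: mult.assoc)
  have ln: "ln (4 * pi * s) + ln (4 * pi * t) = ln (4 * pi * (s + t)) + ln (4 * pi * r)"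
    using s t st by (simp add: r_def ln_mult ln_div)
  have Lne: "Ln (of_real (4 * pi) * (of_real s * a)) + Ln (of_real (4 * pi) * (of_real t * a)) =
      Ln (of_real (4 * pi) * (of_real (s + t) * a)) + Ln (of_real (4 * pi) * (of_real r * a))"
    unfolding Lf[OF s] Lf[OF t] Lf[OF st(1)] Lf[OF st(2)]
    using arg_cong[OF ln, of complex_of_real] unfolding of_real_add by (simp add: algebra_simps)
  have quad: "- (1 / (4 * (of_real u * a))) * of_real k = - (1 / (4 * a)) * of_real (k / u)" if "u > 0" for u k
    using that a0 by (simp add: field_simps)
  have prod: "heat (of_real s * a) (w - \<eta>) * heat (of_real t * a) \<eta> =
      heat (of_real (s + t) * a) w * heat (of_real r * a) (- m + \<eta>)" for \<eta>
  proof -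
    have e: "exp A * exp B * (exp C * exp D) = exp E * exp F * (exp G * exp (H :: complex))"
      if "A + C = E + G" "B + D = F + H" for A B C D E F G H
    proof -
      have "exp (A + C) * exp (B + D) = exp (E + G) * exp (F + H)" using that by simp
      then show ?thesis by (simp add: exp_add mult_ac)
    qed
    show ?thesis
      unfolding heat_def
    proof (rule e)
      show "- (of_nat DIM('a) / 2) * Ln (of_real (4 * pi) * (of_real s * a)) + - (of_nat DIM('a) / 2) * Ln (of_real (4 * pi) * (of_real t * a)) =
          - (of_nat DIM('a) / 2) * Ln (of_real (4 * pi) * (of_real (s + t) * a)) + - (of_nat DIM('a) / 2) * Ln (of_real (4 * pi) * (of_real r * a))"
        using arg_cong[OF Lne, of "\<lambda>x. - (of_nat DIM('a) / 2) * x"] by (simp only: distrib_left)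
      show "- (1 / (4 * (of_real s * a))) * of_real ((norm (w - \<eta>))\<^sup>2) + - (1 / (4 * (of_real t * a))) * of_real ((norm \<eta>)\<^sup>2) =
          - (1 / (4 * (of_real (s + t) * a))) * of_real ((norm w)\<^sup>2) + - (1 / (4 * (of_real r * a))) * of_real ((norm (- m + \<eta>))\<^sup>2)"
        unfolding quad[OF s] quad[OF t] quad[OF st(1)] quad[OF st(2)]
        using arg_cong[OF sq[of \<eta>], of "\<lambda>x. - (1 / (4 * a)) * of_real x"] by (simp only: distrib_left of_real_add)
    qed
  qed
  have "integrable lborel (heat (of_real r * a) :: 'a \<Rightarrow> complex)"
    using a st by (intro integrable_heat) simp
  then have "(\<integral>\<eta>. heat (of_real r * a) (- m + \<eta>) \<partial>lborel) = (\<integral>(\<eta>::'a). heat (of_real r * a) \<eta> \<partial>lborel)"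
    by (intro integral_lborel_plus) auto
  also have "\<dots> = 1"
    using a st by (intro integral_heat) simp
  finally show ?thesis
    unfolding conv_def prod by simp
qed

section \<open>Exponential of a skew-symmetric matrix\<close>

lemma mat_pow_scaleR: "mat_pow (c *\<^sub>R A) k = c ^ k *\<^sub>R mat_pow A k"
  for A :: "'a::real_algebra_1 ^ 'n ^ 'n"
  by (induction k) (simp_all add: matrix_matrix_mult_def vec_eq_iff scaleR_sum_right mult.commute[of c])

lemma mat_exp_zero: "mat_exp 0 = (mat 1 :: 'a::real_normed_field ^ 'n ^ 'n)"
proof -
  have "(1 / fact k) *\<^sub>R mat_pow (0 :: 'a ^ 'n ^ 'n) k = (if k = 0 then mat 1 else 0)" for k
    by (cases k) (simp_all add: matrix_matrix_mult_def vec_eq_iff)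
  then show ?thesis
    unfolding mat_exp_def using suminf_finite[of "{0}" "\<lambda>k. if k = 0 then mat 1 else (0 :: 'a ^ 'n ^ 'n)"] by simp
qed

text \<open>Each coordinate is an everywhere convergent power series in t and may be differentiated
  termwise. In \<open>diffs\<close> the factor \<open>Suc k\<close> cancels against the factorial,
  and the remaining power \<open>S ** mat_pow S k\<close> releases one \<open>S\<close>.\<close>

lemma has_derivative_mat_exp_vec:
  fixes S :: "real ^ 'd ^ 'd"
  shows "((\<lambda>t. (mat_exp (t *\<^sub>R S) *v x) $ i) has_real_derivative (S *v (mat_exp (t *\<^sub>R S) *v x)) $ i) (at t)"
proof -
  define c where "c = (\<lambda>i k. (mat_pow S k *v x) $ i / fact k)"
  have sums: "(\<lambda>k. c i k * t ^ k) sums ((mat_exp (t *\<^sub>R S) *v x) $ i)" for i t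
  proof -
    have "linear (\<lambda>M::real^'d^'d. (M *v x) $ i)"
      by (rule linearI) (simp_all add: matrix_vector_mult_add_rdistrib flip: scaleR_matrix_vector_assoc)
    then have "(\<lambda>k. ((1 / fact k) *\<^sub>R mat_pow (t *\<^sub>R S) k *v x) $ i) sums ((mat_exp (t *\<^sub>R S) *v x) $ i)"
      by (intro bounded_linear.sums[OF _ mat_exp_sums]) (simp add: linear_conv_bounded_linear)
    then show ?thesis
      by (simp add: c_def mat_pow_scaleR mult.commute flip: scaleR_matrix_vector_assoc)
  qed
  have "((\<lambda>t. \<Sum>k. c i k * t ^ k) has_field_derivative (\<Sum>k. diffs (c i) k * t ^ k)) (at t)"
    by (rule termdiffs_strong_converges_everywhere) (rule sums_summable[OF sums])
  moreover have "(\<lambda>k. diffs (c i) k * t ^ k) sums (S *v (mat_exp (t *\<^sub>R S) *v x)) $ i"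
  proof -
    have "diffs (c i) k * t ^ k = (\<Sum>j\<in>UNIV. S $ i $ j * (c j k * t ^ k))" for k
    proof -
      have "diffs (c i) k = (S *v (mat_pow S k *v x)) $ i / fact k"
        by (simp add: diffs_def c_def matrix_vector_mul_assoc del: of_nat_Suc)
      then show ?thesis
        by (simp add: matrix_vector_mult_def[of S] c_def sum_distrib_right sum_divide_distrib mult.assoc)
    qed
    moreover have "(\<lambda>k. \<Sum>j\<in>UNIV. S $ i $ j * (c j k * t ^ k)) sums (\<Sum>j\<in>UNIV. S $ i $ j * (mat_exp (t *\<^sub>R S) *v x) $ j)"
      by (intro sums_sum sums_mult sums)
    ultimately show ?thesis
      by (simp add: matrix_vector_mult_def[of S])
  qed
  moreover have "(\<Sum>k. c i k * t ^ k) = (mat_exp (t *\<^sub>R S) *v x) $ i" for t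
    using sums by (simp add: sums_iff)
  ultimately show ?thesis
    by (simp add: sums_iff)
qed

text \<open>Conservation of the norm along \<open>u' = S u\<close> gives both the isometry property of \<open>exp(tS)\<close> and,
  applied to the difference of two solutions, the group law.\<close>

lemma skew_flow_norm_const:
  fixes S :: "real ^ 'd ^ 'd"
  assumes S: "transpose S = - S"
    and u: "\<And>t i. ((\<lambda>t. u t $ i) has_real_derivative (S *v u t) $ i) (at t)"
  shows "norm (u t) = norm (u 0)"
proof -
  have skew: "v \<bullet> (S *v v) = 0" for v
  proof -
    have "- S *v v = - (S *v v)"
      by (simp add: matrix_vector_mult_def vec_eq_iff sum_negf)
    then have "v v* S = - (S *v v)"
      using transpose_matrix_vector[of S v] S by simp
    then show ?thesis
      using dot_lmul_matrix[of v S v] by (simp add: inner_commute[of "S *v v"])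
  qed
  have "((\<lambda>t. u t \<bullet> u t) has_real_derivative 0) (at t)" for t
  proof -
    have "((\<lambda>t. \<Sum>i\<in>UNIV. u t $ i * u t $ i) has_real_derivative (\<Sum>i\<in>UNIV. (S *v u t) $ i * u t $ i + (S *v u t) $ i * u t $ i)) (at t)"
      by (intro DERIV_sum DERIV_mult u)
    also have "(\<Sum>i\<in>UNIV. (S *v u t) $ i * u t $ i + (S *v u t) $ i * u t $ i) = 2 * (u t \<bullet> (S *v u t))"
      by (simp add: inner_vec_def sum_distrib_left mult_ac)
    finally show ?thesis
      unfolding skew by (simp add: inner_vec_def)
  qed
  then have "u t \<bullet> u t = u 0 \<bullet> u 0"
    by (rule DERIV_isconst_all[rule_format])
  then show ?thesis by (simp add: norm_eq_sqrt_inner)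
qed

lemma orthogonal_mat_exp_skew:
  fixes S :: "real ^ 'd ^ 'd"
  assumes S: "transpose S = - S"
  shows "orthogonal_transformation (\<lambda>x. mat_exp (t *\<^sub>R S) *v x)"
  unfolding orthogonal_transformation
  using skew_flow_norm_const[OF S has_derivative_mat_exp_vec]
  by (simp add: mat_exp_zero)

lemma mat_exp_skew_add:
  fixes S :: "real ^ 'd ^ 'd"
  assumes S: "transpose S = - S"
  shows "mat_exp ((s + t) *\<^sub>R S) *v x = mat_exp (s *\<^sub>R S) *v (mat_exp (t *\<^sub>R S) *v x)"
proof -
  \<comment> \<open>In s this is a solution of the linear equation that vanishes at
    \<open>s = 0\<close>, so its constant norm is 0.\<close>
  define w where "w = (\<lambda>s. mat_exp ((s + t) *\<^sub>R S) *v x - mat_exp (s *\<^sub>R S) *v (mat_exp (t *\<^sub>R S) *v x))"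
  have "((\<lambda>s. w s $ i) has_real_derivative (S *v w s) $ i) (at s)" for s i
  proof -
    have "((\<lambda>s. (mat_exp ((s + t) *\<^sub>R S) *v x) $ i) has_real_derivative (S *v (mat_exp ((s + t) *\<^sub>R S) *v x)) $ i) (at s)"
      using has_derivative_mat_exp_vec[of S x i "s + t"] by (simp add: DERIV_shift)
    then show ?thesis
      unfolding w_def by (auto simp: matrix_vector_mult_diff_distrib intro!: DERIV_diff has_derivative_mat_exp_vec)
  qed
  from skew_flow_norm_const[OF S this, of s] show ?thesis
    by (simp add: w_def mat_exp_zero)
qed

section \<open>Functional calculus for diagonalized matrices\<close>

text \<open>For fixed invertible \<open>Y\<close> this is an algebra homomorphism in
  \<open>l\<close>. With \<open>A\<close> and \<open>B\<close> in this form for the same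
  \<open>Y\<close>, every operation in the heat kernel acts on eigenvalues alone.\<close>

definition conj_diag :: "complex ^ 'n ^ 'n \<Rightarrow> ('n \<Rightarrow> complex) \<Rightarrow> complex ^ 'n ^ 'n" where
  "conj_diag Y l = Y ** diag_mat l ** matrix_inv Y"

lemma matrix_inv_inverse:
  fixes Y :: "'a::semiring_1 ^ 'n ^ 'n"
  assumes "invertible Y"
  shows "matrix_inv Y ** Y = mat 1" "Y ** matrix_inv Y = mat 1"
  using someI_ex[OF assms[unfolded invertible_def]] by (simp_all add: matrix_inv_def)

lemma matrix_inv_eqI:
  fixes X :: "'a::semiring_1 ^ 'n ^ 'n"
  assumes "X ** Z = mat 1" "Z ** X = mat 1"
  shows "matrix_inv X = Z"
proof -
  have inv: "invertible X" using assms by (auto simp: invertible_def)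
  have "matrix_inv X ** (X ** Z) = (matrix_inv X ** X) ** Z"
    by (rule matrix_mul_assoc)
  then show ?thesis
    by (simp only: assms matrix_inv_inverse[OF inv] matrix_mul_lid matrix_mul_rid)
qed

lemma linear_conj: "linear (\<lambda>M. Y ** M ** Z)" for Y Z :: "complex ^ 'n ^ 'n"
proof (rule linearI)
  show "Y ** (M + N) ** Z = Y ** M ** Z + Y ** N ** Z" for M N
    by (simp add: matrix_matrix_mult_def vec_eq_iff distrib_left distrib_right sum.distrib)
  show "Y ** (c *\<^sub>R M) ** Z = c *\<^sub>R (Y ** M ** Z)" for c M
    by (simp add: matrix_scalar_ac flip: scalar_matrix_assoc)
qed

context
  fixes Y :: "complex ^ 'n ^ 'n"
  assumes Y: "invertible Y"
begin

lemma conj_diag_mult: "conj_diag Y l ** conj_diag Y m = conj_diag Y (\<lambda>k. l k * m k)"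
proof -
  have "diag_mat l ** diag_mat m = diag_mat (\<lambda>k. l k * m k)"
    unfolding vec_eq_iff diag_mat_mult_nth by (simp add: diag_mat_def)
  moreover have "conj_diag Y l ** conj_diag Y m = Y ** diag_mat l ** (matrix_inv Y ** Y) ** diag_mat m ** matrix_inv Y"
    unfolding conj_diag_def by (simp only: matrix_mul_assoc)
  moreover have "Y ** diag_mat l ** diag_mat m ** matrix_inv Y = Y ** (diag_mat l ** diag_mat m) ** matrix_inv Y"
    by (simp only: matrix_mul_assoc)
  ultimately show ?thesis
    by (simp only: matrix_inv_inverse[OF Y] matrix_mul_rid conj_diag_def)
qed

lemma conj_diag_one: "conj_diag Y (\<lambda>_. 1) = mat 1"
proof -
  have "diag_mat (\<lambda>_. 1) = (mat 1 :: complex ^ 'n ^ 'n)"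
    by (simp add: diag_mat_def mat_def)
  then show ?thesis
    by (simp add: conj_diag_def matrix_inv_inverse[OF Y])
qed

lemma conj_diag_diff: "conj_diag Y l - conj_diag Y m = conj_diag Y (\<lambda>k. l k - m k)"
proof -
  have "diag_mat l - diag_mat m = diag_mat (\<lambda>k. l k - m k)"
    by (simp add: diag_mat_def vec_eq_iff)
  then show ?thesis
    unfolding conj_diag_def using linear_diff[OF linear_conj[of Y "matrix_inv Y"], of "diag_mat l" "diag_mat m"] by simp
qed

lemma conj_diag_scaleR: "c *\<^sub>R conj_diag Y l = conj_diag Y (\<lambda>k. of_real c * l k)"
proof -
  have "c *\<^sub>R diag_mat l = diag_mat (\<lambda>k. of_real c * l k)"
    by (simp add: diag_mat_def vec_eq_iff scaleR_conv_of_real[where 'a = complex])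
  then show ?thesis
    unfolding conj_diag_def using linear_scale[OF linear_conj[of Y "matrix_inv Y"], of c "diag_mat l"] by simp
qed

lemma conj_diag_uminus: "- conj_diag Y l = conj_diag Y (\<lambda>k. - l k)"
  using conj_diag_scaleR[of "- 1" l] by simp

lemma matrix_inv_conj_diag:
  assumes "\<And>k. l k \<noteq> 0"
  shows "matrix_inv (conj_diag Y l) = conj_diag Y (\<lambda>k. 1 / l k)"
  by (rule matrix_inv_eqI) (simp_all add: conj_diag_mult assms conj_diag_one)

lemma mat_pow_conj_diag: "mat_pow (conj_diag Y l) k = conj_diag Y (\<lambda>i. l i ^ k)"
  by (induction k) (simp_all add: conj_diag_one conj_diag_mult)

text \<open>Conjugation by \<open>Y\<close> is linear, hence continuous in finite dimension, and so
  passes through the entrywise convergent exponential series of the diagonal matrix.\<close>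

lemma mat_exp_conj_diag: "mat_exp (conj_diag Y l) = conj_diag Y (\<lambda>k. exp (l k))"
proof -
  have "(\<lambda>k. diag_mat (\<lambda>i. l i ^ k /\<^sub>R fact k)) sums diag_mat (\<lambda>i. exp (l i))"
    unfolding sums_def
  proof (intro vec_tendstoI)
    fix i j
    have "(\<lambda>n. \<Sum>k<n. if i = j then l i ^ k /\<^sub>R fact k else 0) \<longlonglongrightarrow> (if i = j then exp (l i) else 0)"
      using exp_converges[of "l i"] by (auto simp: sums_def)
    then show "(\<lambda>n. (\<Sum>k<n. diag_mat (\<lambda>i. l i ^ k /\<^sub>R fact k)) $ i $ j) \<longlonglongrightarrow> diag_mat (\<lambda>i. exp (l i)) $ i $ j"
      by (simp add: diag_mat_def sum_component)
  qed
  then have "(\<lambda>k. conj_diag Y (\<lambda>i. l i ^ k /\<^sub>R fact k)) sums conj_diag Y (\<lambda>i. exp (l i))"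
    unfolding conj_diag_def
    by (intro bounded_linear.sums[where f = "\<lambda>M. Y ** M ** matrix_inv Y"])
      (simp_all add: linear_conj flip: linear_conv_bounded_linear)
  moreover have "(1 / fact k) *\<^sub>R mat_pow (conj_diag Y l) k = conj_diag Y (\<lambda>i. l i ^ k /\<^sub>R fact k)" for k
    by (simp add: mat_pow_conj_diag conj_diag_scaleR scaleR_conv_of_real[where 'a = complex] divide_inverse)
  ultimately show ?thesis
    using mat_exp_sums[of "conj_diag Y l"] by (simp add: sums_unique2)
qed

text \<open>Expansion along the eigenvectors; applied to the kernel it splits the vector-valued
  integral into scalar ones.\<close>

lemma conj_diag_vec: "conj_diag Y l *v v = (\<Sum>k\<in>UNIV. (l k * (matrix_inv Y *v v) $ k) *s column k Y)"
proof -
  have "(diag_mat l *v w) $ k = l k * w $ k" for w k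
    by (simp add: diag_mat_def matrix_vector_mult_def if_distrib if_distribR cong: if_cong)
  then have "(\<Sum>k\<in>UNIV. (l k * (matrix_inv Y *v v) $ k) *s column k Y) = Y *v (diag_mat l *v (matrix_inv Y *v v))"
    by (simp add: matrix_mult_sum[of Y])
  then show ?thesis
    by (simp add: conj_diag_def matrix_vector_mul_assoc matrix_mul_assoc)
qed

text \<open>Carries the spectral hypothesis on \<open>A\<close> over to the diagonal entries; the
  eigenvector is the k-th column of \<open>Y\<close>, the image of the k-th unit vector.\<close>

lemma mat_eigenvalue_conj_diag: "mat_eigenvalue (conj_diag Y l) (l k)"
  unfolding mat_eigenvalue_def
proof (intro exI conjI)
  have YiY: "matrix_inv Y *v column k Y = axis k 1"
  proof -
    have "column k Y = Y *v axis k 1"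
      by (simp add: matrix_vector_mult_def column_def vec_eq_iff axis_def if_distrib cong: if_cong)
    then show ?thesis
      by (simp add: matrix_vector_mul_assoc matrix_inv_inverse[OF Y])
  qed
  then show "column k Y \<noteq> 0"
    by (metis axis_eq_0_iff matrix_vector_mult_0_right zero_neq_one)
  show "conj_diag Y l *v column k Y = l k *s column k Y"
    unfolding conj_diag_vec YiY by (simp add: axis_def if_distrib if_distribR cong: if_cong)
qed

text \<open>Power, inverse and exponential are all taken in the eigenbasis \<open>Y\<close>, so the
  matrix kernel is diagonal there. Its exponential splits because the eigenvalues are commuting
  scalars.\<close>

lemma heat_kernel_conj_diag:
  fixes S :: "real ^ 'd ^ 'd"
  assumes t: "t > 0" and a: "\<And>k. Re (a k) > 0"
  shows "heat_kernel (conj_diag Y a) (conj_diag Y b) S x \<xi> t =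
    conj_diag Y (\<lambda>k. exp (- (of_real t * b k)) * heat (of_real t * a k) (mat_exp (t *\<^sub>R S) *v x - \<xi>))"
proof -
  have a0: "a k \<noteq> 0" for k using a[of k] by auto
  let ?r = "(norm (mat_exp (t *\<^sub>R S) *v x - \<xi>))\<^sup>2"
  have 1: "mat_cpow ((4 * pi * t) *\<^sub>R conj_diag Y a) (- (of_nat CARD('d) / 2)) =
      conj_diag Y (\<lambda>k. exp (- (of_nat CARD('d) / 2) * Ln (of_real (4 * pi * t) * a k)))"
    unfolding conj_diag_scaleR by (unfold conj_diag_def) (rule mat_cpow_eq[OF Y refl])
  have "- (t *\<^sub>R conj_diag Y b) - ?r *\<^sub>R matrix_inv ((4 * t) *\<^sub>R conj_diag Y a)
      = conj_diag Y (\<lambda>k. of_real (- t) * b k - of_real ?r * (1 / (of_real (4 * t) * a k)))"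
    unfolding conj_diag_scaleR using a0 t
    by (subst matrix_inv_conj_diag) (simp_all add: conj_diag_scaleR conj_diag_diff conj_diag_uminus)
  then have 2: "mat_exp (- (t *\<^sub>R conj_diag Y b) - ?r *\<^sub>R matrix_inv ((4 * t) *\<^sub>R conj_diag Y a)) =
      conj_diag Y (\<lambda>k. exp (of_real (- t) * b k - of_real ?r * (1 / (of_real (4 * t) * a k))))"
    by (simp only: mat_exp_conj_diag)
  have 3: "exp (- (of_nat CARD('d) / 2) * Ln (of_real (4 * pi * t) * a k)) *
        exp (of_real (- t) * b k - of_real ?r * (1 / (of_real (4 * t) * a k))) =
      exp (- (of_real t * b k)) * heat (of_real t * a k) (mat_exp (t *\<^sub>R S) *v x - \<xi>)" for k
  proof -
    have "exp (of_real (- t) * b k - of_real ?r * (1 / (of_real (4 * t) * a k))) =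
        exp (- (of_real t * b k)) * exp (- (1 / (4 * (of_real t * a k))) * of_real ?r)"
      unfolding exp_add[symmetric] by (simp add: mult.assoc)
    then show ?thesis
      by (simp add: heat_def mult_ac)
  qed
  show ?thesis
    unfolding heat_kernel_def 1 2 conj_diag_mult 3 ..
qed

end

section \<open>Uniform continuity along the rotational flow\<close>

text \<open>Membership in \<^term>\<open>C_rub S\<close> in epsilon-delta form. The values may lie in any normed space, so that
  the notion also applies to the scalar coordinates of a vector-valued function.\<close>

definition rub :: "real ^ 'd ^ 'd \<Rightarrow> (real ^ 'd \<Rightarrow> 'b::real_normed_vector) \<Rightarrow> bool" where
  "rub S f \<longleftrightarrow> bounded (range f) \<and> uniformly_continuous_on UNIV f \<and>
     (\<forall>e>0. \<exists>\<delta>>0. \<forall>t x. \<bar>t\<bar> < \<delta> \<longrightarrow> norm (f (mat_exp (t *\<^sub>R S) *v x) - f x) < e)"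

lemma rubD_rot:
  assumes "rub S f" "e > 0"
  obtains \<delta> where "\<delta> > 0" "\<And>t x. \<bar>t\<bar> < \<delta> \<Longrightarrow> norm (f (mat_exp (t *\<^sub>R S) *v x) - f x) < e"
  using assms unfolding rub_def by blast

lemma rubD_unif:
  assumes "rub S f" "e > 0"
  obtains \<delta> where "\<delta> > 0" "\<And>x y. norm (x - y) < \<delta> \<Longrightarrow> norm (f x - f y) < e"
  using assms unfolding rub_def uniformly_continuous_on_def dist_norm by (metis UNIV_I)

lemma rubD_bounded:
  assumes "rub S f"
  obtains K where "\<And>x. norm (f x) \<le> K"
  using assms unfolding rub_def bounded_iff by auto

lemma rub_measurable:
  fixes f :: "real ^ 'd \<Rightarrow> 'b::real_normed_vector"
  assumes "rub S f"
  shows "f \<in> borel_measurable borel"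
  using assms unfolding rub_def
  by (intro borel_measurable_continuous_onI uniformly_continuous_imp_continuous) auto

lemma rubI:
  assumes "\<And>x. norm (f x) \<le> K"
    and "\<And>e. e > 0 \<Longrightarrow> \<exists>\<delta>>0. \<forall>x y. norm (x - y) < \<delta> \<longrightarrow> norm (f x - f y) < e"
    and "\<And>e. e > 0 \<Longrightarrow> \<exists>\<delta>>0. \<forall>t x. \<bar>t\<bar> < \<delta> \<longrightarrow> norm (f (mat_exp (t *\<^sub>R S) *v x) - f x) < e"
  shows "rub S f"
  unfolding rub_def uniformly_continuous_on_def dist_norm bounded_iff
  using assms by (metis (no_types, lifting) UNIV_I rangeE norm_minus_commute)

text \<open>Serves the passage from a vector-valued function to its coordinates and back along the
  eigenvectors, as well as scalar multiples.\<close>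

lemma rub_bounded_linear:
  assumes f: "rub S f" and h: "bounded_linear h"
  shows "rub S (\<lambda>x. h (f x))"
proof -
  obtain C where C: "C > 0" "\<And>x. norm (h x) \<le> norm x * C"
    using bounded_linear.pos_bounded[OF h] by blast
  have diff: "norm (h x - h y) < e" if "norm (x - y) < e / C" for x y e
  proof -
    have "norm (h x - h y) \<le> norm (x - y) * C"
      using C(2)[of "x - y"] by (simp add: linear_diff[OF bounded_linear.linear[OF h]])
    also have "\<dots> < e" using that C by (simp add: pos_less_divide_eq)
    finally show ?thesis .
  qed
  obtain K where K: "\<And>x. norm (f x) \<le> K" using rubD_bounded[OF f] by blast
  show ?thesis
  proof (rule rubI)
    show "norm (h (f x)) \<le> K * C" for x
      using C K[of x] by (meson mult_right_mono less_imp_le order_trans)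
    fix e :: real assume "e > 0"
    then have e: "e / C > 0" using C by simp
    show "\<exists>\<delta>>0. \<forall>x y. norm (x - y) < \<delta> \<longrightarrow> norm (h (f x) - h (f y)) < e"
      using rubD_unif[OF f e] diff by metis
    show "\<exists>\<delta>>0. \<forall>t x. \<bar>t\<bar> < \<delta> \<longrightarrow> norm (h (f (mat_exp (t *\<^sub>R S) *v x)) - h (f x)) < e"
      using rubD_rot[OF f e] diff by metis
  qed
qed

lemma rub_zero: "rub S (\<lambda>_. 0)"
  by (rule rubI[of _ 0]) (auto intro: exI[of _ 1])

lemma rub_add:
  assumes f: "rub S f" and g: "rub S g"
  shows "rub S (\<lambda>x. f x + g x)"
proof -
  have add: "norm (a + b - (c + d)) < e" if "norm (a - c) < e / 2" "norm (b - d) < e / 2"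
    for a b c d :: 'b and e :: real
    using that norm_triangle_ineq[of "a - c" "b - d"] by (simp add: algebra_simps)
  obtain K where K: "\<And>x. norm (f x) \<le> K" using rubD_bounded[OF f] by blast
  obtain L where L: "\<And>x. norm (g x) \<le> L" using rubD_bounded[OF g] by blast
  show ?thesis
  proof (rule rubI)
    show "norm (f x + g x) \<le> K + L" for x
      using K L by (intro norm_triangle_mono)
    fix e :: real assume "e > 0"
    then have e: "e / 2 > 0" by simp
    obtain \<delta>1 where d1: "\<delta>1 > 0" "\<And>x y. norm (x - y) < \<delta>1 \<Longrightarrow> norm (f x - f y) < e / 2"
      using rubD_unif[OF f e] by blast
    obtain \<delta>2 where d2: "\<delta>2 > 0" "\<And>x y. norm (x - y) < \<delta>2 \<Longrightarrow> norm (g x - g y) < e / 2"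
      using rubD_unif[OF g e] by blast
    show "\<exists>\<delta>>0. \<forall>x y. norm (x - y) < \<delta> \<longrightarrow> norm (f x + g x - (f y + g y)) < e"
      using d1 d2 by (intro exI[of _ "min \<delta>1 \<delta>2"]) (auto intro!: add)
    obtain \<delta>1 where d1: "\<delta>1 > 0" "\<And>t x. \<bar>t\<bar> < \<delta>1 \<Longrightarrow> norm (f (mat_exp (t *\<^sub>R S) *v x) - f x) < e / 2"
      using rubD_rot[OF f e] by blast
    obtain \<delta>2 where d2: "\<delta>2 > 0" "\<And>t x. \<bar>t\<bar> < \<delta>2 \<Longrightarrow> norm (g (mat_exp (t *\<^sub>R S) *v x) - g x) < e / 2"
      using rubD_rot[OF g e] by blast
    show "\<exists>\<delta>>0. \<forall>t x. \<bar>t\<bar> < \<delta> \<longrightarrow>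
        norm (f (mat_exp (t *\<^sub>R S) *v x) + g (mat_exp (t *\<^sub>R S) *v x) - (f x + g x)) < e"
      using d1 d2 by (intro exI[of _ "min \<delta>1 \<delta>2"]) (auto intro!: add)
  qed
qed

lemma rub_sum:
  assumes "\<And>k. k \<in> I \<Longrightarrow> rub S (f k)"
  shows "rub S (\<lambda>x. \<Sum>k\<in>I. f k x)"
  using assms by (induction I rule: infinite_finite_induct) (auto intro: rub_zero rub_add)

text \<open>The supremum formulation uses \<open>exp(-tS)\<close> and \<open>rub\<close> uses
  \<open>exp(tS)\<close>; replacing t by -t matches them, as the condition on the absolute value of
  t is symmetric.\<close>

lemma C_rub_iff: "v \<in> C_rub S \<longleftrightarrow> rub S v"
proof -
  let ?R = "\<lambda>t x. norm (v (mat_exp (t *\<^sub>R S) *v x) - v x)"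
  have ub: "v \<in> C_ub \<longleftrightarrow> bounded (range v) \<and> uniformly_continuous_on UNIV v"
    by (auto simp: C_ub_def bcontfun_def uniformly_continuous_imp_continuous)
  have "((\<lambda>t. SUP x. ?R (- t) x) \<longlongrightarrow> 0) (at 0) \<longleftrightarrow> (\<forall>e>0. \<exists>\<delta>>0. \<forall>t x. \<bar>t\<bar> < \<delta> \<longrightarrow> ?R t x < e)"
    if bdd: "bounded (range v)"
  proof -
    obtain K where K: "\<And>x. norm (v x) \<le> K" using bdd unfolding bounded_iff by auto
    have "?R t x \<le> K + K" for t x
      using norm_triangle_ineq4[of "v (mat_exp (t *\<^sub>R S) *v x)" "v x"] K[of x] K[of "mat_exp (t *\<^sub>R S) *v x"]
      by linarith
    then have B: "bdd_above (range (?R t))" for t by (auto simp: bdd_above_def)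
    have up: "?R t x \<le> (SUP x. ?R t x)" for t x
      using B by (intro cSUP_upper) auto
    have nonneg: "0 \<le> (SUP x. ?R t x)" for t
      using up[of t undefined] norm_ge_zero order_trans by blast
    show ?thesis
    proof
      assume lim: "((\<lambda>t. SUP x. ?R (- t) x) \<longlongrightarrow> 0) (at 0)"
      show "\<forall>e>0. \<exists>\<delta>>0. \<forall>t x. \<bar>t\<bar> < \<delta> \<longrightarrow> ?R t x < e"
      proof (intro allI impI)
        fix e :: real assume e: "e > 0"
        then obtain \<delta> where d: "\<delta> > 0" "\<And>t. t \<noteq> 0 \<Longrightarrow> \<bar>t\<bar> < \<delta> \<Longrightarrow> \<bar>SUP x. ?R (- t) x\<bar> < e"
          using lim unfolding LIM_eq by auto
        have "?R t x < e" if "\<bar>t\<bar> < \<delta>" for t x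
        \<comment> \<open>The limit at 0 says nothing about \<open>t = 0\<close>, where the
          difference vanishes.\<close>
        proof (cases "t = 0")
          case True
          then show ?thesis using e by (simp add: mat_exp_zero)
        next
          case False
          then show ?thesis using d(2)[of "- t"] that up[of t x] by simp
        qed
        then show "\<exists>\<delta>>0. \<forall>t x. \<bar>t\<bar> < \<delta> \<longrightarrow> ?R t x < e" using d(1) by blast
      qed
    next
      assume eps: "\<forall>e>0. \<exists>\<delta>>0. \<forall>t x. \<bar>t\<bar> < \<delta> \<longrightarrow> ?R t x < e"
      show "((\<lambda>t. SUP x. ?R (- t) x) \<longlongrightarrow> 0) (at 0)"
        unfolding LIM_eq
      proof (intro allI impI)
        fix e :: real assume e: "e > 0"
        \<comment> \<open>Half of \<open>e\<close>, because passing to the supremum weakens the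
          strict bound.\<close>
        then obtain \<delta> where d: "\<delta> > 0" "\<And>t x. \<bar>t\<bar> < \<delta> \<Longrightarrow> ?R t x < e / 2"
          using eps by (metis half_gt_zero)
        have "\<bar>SUP x. ?R (- t) x\<bar> < e" if "\<bar>t\<bar> < \<delta>" for t
        proof -
          have "(SUP x. ?R (- t) x) \<le> e / 2"
            using d(2)[of "- t"] that by (intro cSUP_least) (auto intro: less_imp_le)
          then show ?thesis using nonneg[of "- t"] e by linarith
        qed
        then show "\<exists>s>0. \<forall>t. t \<noteq> 0 \<and> norm (t - 0) < s \<longrightarrow> norm ((SUP x. ?R (- t) x) - 0) < e"
          using d(1) by auto
      qed
    qed
  qed
  then show ?thesis
    unfolding C_rub_def rub_def mem_Collect_eq ub by auto
qed

lemma sup_norm_upper: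
  assumes "\<And>x. norm (v x) \<le> K"
  shows "norm (v x) \<le> sup_norm v"
  unfolding sup_norm_def using assms by (intro cSUP_upper) (auto simp: bdd_above_def)

lemma sup_norm_least:
  assumes "\<And>x. norm (v x) \<le> K"
  shows "sup_norm v \<le> K"
  unfolding sup_norm_def using assms by (intro cSUP_least) auto

section \<open>The scalar semigroups\<close>

definition scalar_T :: "real ^ 'd ^ 'd \<Rightarrow> complex \<Rightarrow> complex \<Rightarrow> real \<Rightarrow> (real ^ 'd \<Rightarrow> complex) \<Rightarrow> real ^ 'd \<Rightarrow> complex" where
  "scalar_T S a b t f x = exp (- (of_real t * b)) * conv (heat (of_real t * a)) f (mat_exp (t *\<^sub>R S) *v x)"

text \<open>Convolution commutes with translations and, by radiality, with the rotations of the
  flow. Increments of \<open>conv g f\<close> are thus convolutions of increments of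
  \<open>f\<close>, bounded by the L^1 norm of \<open>g\<close>.\<close>

lemma rub_conv:
  fixes g :: "real ^ 'd \<Rightarrow> complex"
  assumes S: "transpose S = - S" and g: "integrable lborel g"
    and radial: "\<And>x y. norm x = norm y \<Longrightarrow> g x = g y" and f: "rub S f"
  shows "rub S (conv g f)"
proof -
  \<comment> \<open>Adding 1 makes the divisor positive even if \<open>g\<close> vanishes almost
    everywhere, and turns the final estimate into a strict one.\<close>
  define M where "M = (\<integral>x. norm (g x) \<partial>lborel) + 1"
  have "0 \<le> (\<integral>x. norm (g x) \<partial>lborel)"
    by (rule Bochner_Integration.integral_nonneg_AE) simp
  then have M: "M > 0" "(\<integral>x. norm (g x) \<partial>lborel) < M"
    unfolding M_def by linarith+
  note f_meas = rub_measurable[OF f]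
  obtain K where K: "\<And>x. norm (f x) \<le> K" using rubD_bounded[OF f] by blast
  show ?thesis
  proof (rule rubI)
    show "norm (conv g f x) \<le> K * (\<integral>x. norm (g x) \<partial>lborel)" for x
      by (rule norm_conv_le[OF g f_meas K])
    fix e :: real assume e: "e > 0"
    then have e': "e / M > 0" using M by simp
    have small: "y < e" if "y \<le> e / M * (\<integral>x. norm (g x) \<partial>lborel)" for y
    proof -
      have "e / M * (\<integral>x. norm (g x) \<partial>lborel) < e / M * M"
        using e' M by (intro mult_strict_left_mono) auto
      then show ?thesis using that M by simp
    qed
    obtain \<delta> where d: "\<delta> > 0" "\<And>x y. norm (x - y) < \<delta> \<Longrightarrow> norm (f x - f y) < e / M"
      using rubD_unif[OF f e'] by blast
    have "norm (conv g f x - conv g f y) < e" if "norm (x - y) < \<delta>" for x y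
      using d(2) that by (intro small conv_diff_le[OF g f_meas K]) (auto intro!: less_imp_le)
    then show "\<exists>\<delta>>0. \<forall>x y. norm (x - y) < \<delta> \<longrightarrow> norm (conv g f x - conv g f y) < e"
      using d(1) by blast
    obtain \<delta> where d: "\<delta> > 0" "\<And>t x. \<bar>t\<bar> < \<delta> \<Longrightarrow> norm (f (mat_exp (t *\<^sub>R S) *v x) - f x) < e / M"
      using rubD_rot[OF f e'] by blast
    have "norm (conv g f (mat_exp (t *\<^sub>R S) *v x) - conv g f x) < e" if t: "\<bar>t\<bar> < \<delta>" for t x
    proof -
      let ?U = "\<lambda>x. mat_exp (t *\<^sub>R S) *v x"
      have meas: "(\<lambda>x. f (?U x)) \<in> borel_measurable borel"
        by (rule measurable_compose[OF borel_measurable_continuous_onI f_meas])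
          (rule linear_continuous_on[OF matrix_vector_mul_bounded_linear])
      have "conv g f (?U x) = conv g (\<lambda>x. f (?U x)) x"
        by (rule conv_orthogonal[OF g f_meas orthogonal_mat_exp_skew[OF S] radial, symmetric])
      then have "conv g f (?U x) - conv g f x = conv g (\<lambda>x. (- 1) * f x + f (?U x)) x"
        using conv_linear[OF g f_meas K meas K, of "- 1" x] by simp
      also have "norm \<dots> < e"
        using d(2)[OF t] f_meas meas by (intro small norm_conv_le[OF g]) (auto intro!: less_imp_le)
      finally show ?thesis .
    qed
    then show "\<exists>\<delta>>0. \<forall>t x. \<bar>t\<bar> < \<delta> \<longrightarrow> norm (conv g f (mat_exp (t *\<^sub>R S) *v x) - conv g f x) < e"
      using d(1) by blast
  qed
qed

text \<open>The flow is isometric, which keeps uniform continuity, and its members commute, which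
  keeps continuity along the flow.\<close>

lemma rub_flow:
  fixes f :: "real ^ 'd \<Rightarrow> 'b::real_normed_vector"
  assumes S: "transpose S = - S" and f: "rub S f"
  shows "rub S (\<lambda>x. f (mat_exp (s *\<^sub>R S) *v x))"
proof -
  let ?U = "\<lambda>t x. mat_exp (t *\<^sub>R S) *v x"
  obtain K where K: "\<And>x. norm (f x) \<le> K" using rubD_bounded[OF f] by blast
  have comm: "?U s (?U t x) = ?U t (?U s x)" for t x
    unfolding mat_exp_skew_add[OF S, symmetric] by (simp add: add.commute)
  have iso: "norm (?U s x - ?U s y) = norm (x - y)" for x y
    using orthogonal_transformation_norm[OF orthogonal_mat_exp_skew[OF S], of s "x - y"]
    by (simp add: matrix_vector_mult_diff_distrib)
  show ?thesis
  proof (rule rubI)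
    show "norm (f (?U s x)) \<le> K" for x by (rule K)
    fix e :: real assume e: "e > 0"
    show "\<exists>\<delta>>0. \<forall>x y. norm (x - y) < \<delta> \<longrightarrow> norm (f (?U s x) - f (?U s y)) < e"
      using rubD_unif[OF f e] iso by metis
    show "\<exists>\<delta>>0. \<forall>t x. \<bar>t\<bar> < \<delta> \<longrightarrow> norm (f (?U s (?U t x)) - f (?U s x)) < e"
      using rubD_rot[OF f e] comm by metis
  qed
qed

text \<open>Within distance \<delta> uniform continuity gives \<open>e\<close>; beyond it the
  trivial bound \<open>2 * K\<close> is at most \<open>2 * K / \<delta>\<^sup>2\<close> times the
  squared distance.\<close>

lemma rub_modulus:
  fixes f :: "real ^ 'd \<Rightarrow> 'b::real_normed_vector"
  assumes f: "rub S f" and e: "e > 0"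
  obtains L where "L \<ge> 0" "\<And>x y. norm (f y - f x) \<le> e + L * (norm (y - x))\<^sup>2"
proof -
  obtain K where K: "\<And>x. norm (f x) \<le> K" using rubD_bounded[OF f] by blast
  have "K \<ge> 0" using K[of undefined] norm_ge_zero order_trans by blast
  obtain \<delta> where d: "\<delta> > 0" "\<And>x y. norm (x - y) < \<delta> \<Longrightarrow> norm (f x - f y) < e"
    using rubD_unif[OF f e] by blast
  show ?thesis
  proof
    show "2 * K / \<delta>\<^sup>2 \<ge> 0" using \<open>K \<ge> 0\<close> by simp
    fix x y
    show "norm (f y - f x) \<le> e + 2 * K / \<delta>\<^sup>2 * (norm (y - x))\<^sup>2"
    proof (cases "norm (y - x) < \<delta>")
      case True
      then have "norm (f y - f x) \<le> e" using d(2) by (simp add: less_imp_le)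
      also have "\<dots> \<le> e + 2 * K / \<delta>\<^sup>2 * (norm (y - x))\<^sup>2" using \<open>K \<ge> 0\<close> by simp
      finally show ?thesis .
    next
      case False
      then have "\<delta>\<^sup>2 \<le> (norm (y - x))\<^sup>2" using d(1) by (intro power_mono) auto
      then have "2 * K / \<delta>\<^sup>2 * \<delta>\<^sup>2 \<le> 2 * K / \<delta>\<^sup>2 * (norm (y - x))\<^sup>2"
        using \<open>K \<ge> 0\<close> by (intro mult_left_mono) auto
      then have "2 * K \<le> 2 * K / \<delta>\<^sup>2 * (norm (y - x))\<^sup>2" using d(1) by simp
      then show ?thesis
        using norm_triangle_ineq4[of "f y" "f x"] K[of x] K[of y] e by linarith
    qed
  qed
qed

context
  fixes S :: "real ^ 'd ^ 'd" and a b :: complex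
  assumes S: "transpose S = - S" and a: "Re a > 0"
begin

lemma Re_scale_pos: "t > 0 \<Longrightarrow> Re (of_real t * a) > 0"
  using a by simp

lemma rub_scalar_T:
  assumes "t > 0" "rub S f"
  shows "rub S (scalar_T S a b t f)"
  unfolding scalar_T_def
  by (intro rub_bounded_linear[OF _ bounded_linear_mult_right] rub_flow S
      rub_conv[OF S integrable_heat[OF Re_scale_pos] heat_cong_norm] assms)

lemma scalar_T_linear:
  assumes t: "t > 0" and f: "rub S f" and g: "rub S g"
  shows "scalar_T S a b t (\<lambda>x. c * f x + g x) x = c * scalar_T S a b t f x + scalar_T S a b t g x"
proof -
  obtain K where K: "\<And>x. norm (f x) \<le> K" using rubD_bounded[OF f] by blast
  obtain L where L: "\<And>x. norm (g x) \<le> L" using rubD_bounded[OF g] by blast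
  show ?thesis
    unfolding scalar_T_def
    using conv_linear[OF integrable_heat[OF Re_scale_pos[OF t]] rub_measurable[OF f] K rub_measurable[OF g] L]
    by (simp add: algebra_simps)
qed

lemma norm_scalar_T_le:
  assumes t: "t > 0" and f: "rub S f" and K: "\<And>x. norm (f x) \<le> K"
  shows "norm (scalar_T S a b t f x) \<le> exp (- (t * Re b)) * heat_mass CARD('d) a * K"
  using norm_conv_le[OF integrable_heat[OF Re_scale_pos[OF t]] rub_measurable[OF f] K]
    integral_norm_heat[OF a t, where 'a = "real ^ 'd"]
  by (simp add: scalar_T_def norm_mult norm_exp_eq_Re mult.assoc mult.commute)

text \<open>The inner rotation is pulled out of the outer convolution by radiality. The two kernels
  then merge by associativity and \<open>conv_heat\<close>, the rotations by the group law.\<close>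

lemma scalar_T_add:
  assumes s: "s > 0" and t: "t > 0" and f: "rub S f"
  shows "scalar_T S a b s (scalar_T S a b t f) x = scalar_T S a b (s + t) f x"
proof -
  let ?U = "\<lambda>t x. mat_exp (t *\<^sub>R S) *v x"
  let ?h = "\<lambda>t. heat (of_real t * a) :: real ^ 'd \<Rightarrow> complex"
  obtain K where K: "\<And>x. norm (f x) \<le> K" using rubD_bounded[OF f] by blast
  note hs = integrable_heat[OF Re_scale_pos[OF s], where 'a = "real ^ 'd"]
  note ht = integrable_heat[OF Re_scale_pos[OF t], where 'a = "real ^ 'd"]
  have meas: "conv (?h t) f \<in> borel_measurable borel"
    using ht rub_measurable[OF f] by (intro borel_measurable_conv) auto
  have "conv (?h s) (scalar_T S a b t f) y = exp (- (of_real t * b)) * conv (?h (s + t)) f (?U t y)" for y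
  proof -
    have "conv (?h s) (scalar_T S a b t f) y = exp (- (of_real t * b)) * conv (?h s) (\<lambda>x. conv (?h t) f (?U t x)) y"
      unfolding scalar_T_def conv_def[of "?h s"] by (simp flip: mult.left_commute)
    also have "conv (?h s) (\<lambda>x. conv (?h t) f (?U t x)) y = conv (?h s) (conv (?h t) f) (?U t y)"
      by (rule conv_orthogonal[OF hs meas orthogonal_mat_exp_skew[OF S] heat_cong_norm])
    also have "\<dots> = conv (conv (?h s) (?h t)) f (?U t y)"
      by (rule conv_assoc[OF hs ht rub_measurable[OF f] K])
    also have "conv (?h s) (?h t) = ?h (s + t)"
      using conv_heat[OF a s t] by (intro ext)
    finally show ?thesis .
  qed
  moreover have "?U (s + t) x = ?U t (?U s x)"
    by (simp add: mat_exp_skew_add[OF S, symmetric] add.commute)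
  moreover have "exp (- (of_real (s + t) * b)) = exp (- (of_real s * b)) * exp (- (of_real t * b))"
    unfolding exp_add[symmetric] by (simp add: algebra_simps)
  ultimately show ?thesis
    unfolding scalar_T_def[of S a b s] scalar_T_def[of S a b "s + t"] by (simp only: mult.assoc)
qed

lemma scalar_T_strongly_continuous:
  assumes f: "rub S f" and e: "e > 0"
  shows "\<forall>\<^sub>F t in at_right 0. \<forall>x. norm (scalar_T S a b t f x - f x) \<le> e"
proof -
  obtain K where K: "\<And>x. norm (f x) \<le> K" using rubD_bounded[OF f] by blast
  have K0: "K \<ge> 0" using K[of undefined] norm_ge_zero order_trans by blast
  define M where "M = heat_mass CARD('d) a"
  define C where "C = 8 * (norm a)\<^sup>2 / Re a * 2 powr (real CARD('d) / 2) * M"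
  have M: "M > 0" unfolding M_def using heat_mass_pos[OF a] .
  \<comment> \<open>The denominator collects the coefficients of \<epsilon> in the three error terms
    estimated at the end.\<close>
  define \<epsilon> where "\<epsilon> = e / (2 * M + 4 + K)"
  have eps: "\<epsilon> > 0" "2 * \<epsilon> * M + 4 * \<epsilon> + \<epsilon> * K = e"
  proof -
    have "2 * M + 4 + K > 0" using M K0 by linarith
    then have "\<epsilon> > 0" "\<epsilon> * (2 * M + 4 + K) = e"
      using e by (auto simp: \<epsilon>_def)
    then show "\<epsilon> > 0" "2 * \<epsilon> * M + 4 * \<epsilon> + \<epsilon> * K = e"
      by (auto simp: algebra_simps)
  qed
  obtain L where L: "L \<ge> 0" "\<And>x y. norm (f y - f x) \<le> \<epsilon> + L * (norm (y - x))\<^sup>2"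
    using rub_modulus[OF f eps(1)] by blast
  obtain \<delta> where d: "\<delta> > 0" "\<And>t x. \<bar>t\<bar> < \<delta> \<Longrightarrow> norm (f (mat_exp (t *\<^sub>R S) *v x) - f x) < \<epsilon>"
    using rubD_rot[OF f eps(1)] by blast
  have lim1: "((\<lambda>t. exp (- (complex_of_real t * b))) \<longlongrightarrow> exp (- (of_real 0 * b))) (at_right 0)"
    by (intro tendsto_intros)
  \<comment> \<open>The bound by 1 yields \<open>norm ?c \<le> 2\<close>.\<close>
  have E1: "\<forall>\<^sub>F t in at_right 0. norm (exp (- (complex_of_real t * b)) - 1) < min \<epsilon> 1"
    using tendstoD[OF lim1, of "min \<epsilon> 1"] eps(1) by (simp add: dist_norm)
  have lim2: "((\<lambda>t. L * (t * C)) \<longlongrightarrow> L * (0 * C)) (at_right 0)"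
    by (intro tendsto_intros)
  have E2: "\<forall>\<^sub>F t in at_right 0. \<bar>L * (t * C)\<bar> < \<epsilon>"
    using tendstoD[OF lim2, of \<epsilon>] eps(1) by (simp add: dist_norm)
  have E3: "\<forall>\<^sub>F t in at_right 0. 0 < t \<and> t < \<delta>"
    using d(1) by (auto simp: eventually_at_right_field)
  from E1 E2 E3 show ?thesis
  proof eventually_elim
    case (elim t)
    then have t: "t > 0" "\<bar>t\<bar> < \<delta>" by auto
    let ?c = "exp (- (complex_of_real t * b))"
    have c: "norm (?c - 1) \<le> \<epsilon>" "norm ?c \<le> 2"
      using elim(1) norm_triangle_ineq[of "?c - 1" 1] by auto
    show ?case
    proof
      fix x
      let ?y = "mat_exp (t *\<^sub>R S) *v x"
      let ?h = "heat (of_real t * a) :: real ^ 'd \<Rightarrow> complex"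
      have "norm (conv ?h f ?y - f ?y) \<le> \<epsilon> * (\<integral>\<xi>. norm (?h \<xi>) \<partial>lborel) + L * (\<integral>\<xi>. (norm \<xi>)\<^sup>2 * norm (?h \<xi>) \<partial>lborel)"
        by (rule conv_diff_at_le[OF integrable_heat[OF Re_scale_pos[OF t(1)]] rub_measurable[OF f] K
            integral_heat[OF Re_scale_pos[OF t(1)]] integrable_heat_moment2[OF a t(1)] L(2)])
      also have "\<dots> \<le> \<epsilon> * M + L * (t * C)"
        using integral_norm_heat[OF a t(1), where 'a = "real ^ 'd"] integral_heat_moment2[OF a t(1), where 'a = "real ^ 'd"]
          L(1) less_imp_le[OF eps(1)]
        by (intro add_mono mult_left_mono) (auto simp: M_def C_def)
      also have "\<dots> \<le> \<epsilon> * M + \<epsilon>" using elim(2) by linarith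
      finally have 1: "norm (conv ?h f ?y - f ?y) \<le> \<epsilon> * M + \<epsilon>" .
      \<comment> \<open>Three separate errors: smoothing by the kernel at the rotated point,
        rotation of the argument, and the scalar factor.\<close>
      have "scalar_T S a b t f x - f x = ?c * (conv ?h f ?y - f ?y) + ?c * (f ?y - f x) + (?c - 1) * f x"
        by (simp add: scalar_T_def algebra_simps)
      also have "norm \<dots> \<le> norm ?c * norm (conv ?h f ?y - f ?y) + norm ?c * norm (f ?y - f x) + norm (?c - 1) * norm (f x)"
        unfolding norm_mult[symmetric] by (intro norm_triangle_le add_mono order_refl)
      also have "\<dots> \<le> 2 * (\<epsilon> * M + \<epsilon>) + 2 * \<epsilon> + \<epsilon> * K"
        using c 1 less_imp_le[OF d(2)[OF t(2)]] K[of x] eps(1) by (intro add_mono mult_mono) auto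
      also have "\<dots> = e" using eps(2) by (simp add: algebra_simps)
      finally show "norm (scalar_T S a b t f x - f x) \<le> e" .
    qed
  qed
qed

end

section \<open>The vector-valued semigroup\<close>

context
  fixes Y :: "complex ^ 'n ^ 'n" and S :: "real ^ 'd ^ 'd" and a b :: "'n \<Rightarrow> complex"
  assumes Y: "invertible Y" and S: "transpose S = - S" and a: "\<And>k. Re (a k) > 0"
begin

text \<open>The coordinate functionals of the basis formed by the columns of
  \<open>Y\<close>.\<close>

definition coord :: "'n \<Rightarrow> complex ^ 'n \<Rightarrow> complex" where
  "coord k w = (matrix_inv Y *v w) $ k"

lemma coord_expansion: "w = (\<Sum>k\<in>UNIV. coord k w *s column k Y)"
proof -
  have "(\<Sum>k\<in>UNIV. coord k w *s column k Y) = Y *v (matrix_inv Y *v w)"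
    by (simp add: coord_def matrix_mult_sum[of Y])
  then show ?thesis
    by (simp add: matrix_vector_mul_assoc matrix_inv_inverse[OF Y])
qed

lemma coord_sum: "coord k (\<Sum>j\<in>UNIV. f j *s column j Y) = f k"
proof -
  have "(\<Sum>j\<in>UNIV. f j *s column j Y) = Y *v (\<chi> j. f j)"
    by (simp add: matrix_mult_sum[of Y])
  then show ?thesis
    by (simp add: coord_def matrix_vector_mul_assoc matrix_inv_inverse[OF Y])
qed

lemma coord_linear: "coord k (c *s v + w) = c * coord k v + coord k w"
  by (simp add: coord_def matrix_vector_right_distrib vec.scale[symmetric] matrix_vector_mult_def sum_distrib_left mult_ac
      distrib_left sum.distrib)

lemma bounded_linear_coord: "bounded_linear (coord k)"
proof -
  have "linear (coord k)"
    using coord_linear[of k 1] coord_linear[of k "of_real _" _ 0]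
    by (intro linearI) (simp_all add: coord_def matrix_vector_mult_def scaleR_sum_right distrib_left sum.distrib)
  then show ?thesis by (simp add: linear_conv_bounded_linear)
qed

lemma bounded_linear_smult_column: "bounded_linear (\<lambda>c. c *s column k Y)"
proof -
  have "linear (\<lambda>c. c *s column k Y)"
    by (rule linearI) (simp_all add: vec_eq_iff distrib_right)
  then show ?thesis by (simp add: linear_conv_bounded_linear)
qed

text \<open>The reduction to scalars: the kernel is diagonal in the eigenbasis, and the integral
  commutes with the finite sum and with multiplication of a fixed column.\<close>

lemma semigroup_T_eq:
  assumes t: "t > 0" and v: "rub S v"
  shows "semigroup_T (conj_diag Y a) (conj_diag Y b) S t v x =
    (\<Sum>k\<in>UNIV. scalar_T S (a k) (b k) t (\<lambda>\<xi>. coord k (v \<xi>)) x *s column k Y)"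
proof -
  let ?g = "\<lambda>k \<xi>. exp (- (of_real t * b k)) * (heat (of_real t * a k) (mat_exp (t *\<^sub>R S) *v x - \<xi>) * coord k (v \<xi>))"
  have int: "integrable lborel (?g k)" for k
  proof -
    have cv: "rub S (\<lambda>\<xi>. coord k (v \<xi>))"
      by (rule rub_bounded_linear[OF v bounded_linear_coord])
    obtain K where K: "\<And>\<xi>. norm (coord k (v \<xi>)) \<le> K" using rubD_bounded[OF cv] by blast
    show ?thesis
      by (intro integrable_mult_right integrable_conv[OF integrable_heat rub_measurable[OF cv] K])
        (simp add: t a)
  qed
  have int': "integrable lborel (\<lambda>\<xi>. ?g k \<xi> *s column k Y)" for k
    by (rule integrable_bounded_linear[OF bounded_linear_smult_column int])
  have "semigroup_T (conj_diag Y a) (conj_diag Y b) S t v x = (\<integral>\<xi>. (\<Sum>k\<in>UNIV. ?g k \<xi> *s column k Y) \<partial>lborel)"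
    using t by (simp add: semigroup_T_def heat_kernel_conj_diag[OF Y t a] conj_diag_vec[OF Y] coord_def mult.assoc)
  also have "\<dots> = (\<Sum>k\<in>UNIV. \<integral>\<xi>. ?g k \<xi> *s column k Y \<partial>lborel)"
    by (rule Bochner_Integration.integral_sum) (rule int')
  also have "\<dots> = (\<Sum>k\<in>UNIV. scalar_T S (a k) (b k) t (\<lambda>\<xi>. coord k (v \<xi>)) x *s column k Y)"
    unfolding integral_bounded_linear[OF bounded_linear_smult_column int] by (simp add: scalar_T_def conv_def)
  finally show ?thesis .
qed

text \<open>Each clause follows coordinatewise through \<open>semigroup_T_eq\<close>. The value
  \<open>t = 0\<close> is treated apart, since there the operator is the identity by definition and
  not an integral.\<close>

lemma C0_semigroup_conj_diag:
  "C0_semigroup_on (C_rub S) (semigroup_T (conj_diag Y a) (conj_diag Y b) S)"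
proof -
  let ?T = "semigroup_T (conj_diag Y a) (conj_diag Y b) S"
  let ?P = "\<lambda>k. scalar_T S (a k) (b k)"
  have rub_coord: "rub S (\<lambda>\<xi>. coord k (v \<xi>))" if "rub S v" for k and v :: "real ^ 'd \<Rightarrow> complex ^ 'n"
    by (rule rub_bounded_linear[OF that bounded_linear_coord])
  have T_0: "?T 0 v = v" for v
    by (simp add: semigroup_T_def)
  have closed: "rub S (?T t v)" if t: "t \<ge> 0" and v: "rub S v" for t v
  proof (cases "t = 0")
    case True
    then show ?thesis using v by (simp add: T_0)
  next
    case False
    then have "t > 0" using t by simp
    then show ?thesis
      unfolding semigroup_T_eq[OF \<open>t > 0\<close> v, abs_def]
      by (intro rub_sum rub_bounded_linear[OF _ bounded_linear_smult_column] rub_scalar_T[OF S a] rub_coord v)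
  qed
  have linear: "?T t (\<lambda>x. c *s v x + w x) = (\<lambda>x. c *s ?T t v x + ?T t w x)"
    if t: "t \<ge> 0" and v: "rub S v" and w: "rub S w" for t c v w
  proof (cases "t = 0")
    case True
    then show ?thesis by (simp add: T_0)
  next
    case False
    then have t: "t > 0" using t by simp
    have "bounded_linear (\<lambda>z::complex ^ 'n. c *s z)"
      using linearI[of "\<lambda>z::complex ^ 'n. c *s z"]
      by (simp add: linear_conv_bounded_linear vector_add_ldistrib vec_eq_iff)
    then have vw: "rub S (\<lambda>x. c *s v x + w x)"
      by (intro rub_add rub_bounded_linear[OF v] w)
    show ?thesis
      unfolding semigroup_T_eq[OF t vw] semigroup_T_eq[OF t v] semigroup_T_eq[OF t w] coord_linear
        scalar_T_linear[OF S a t rub_coord[OF v] rub_coord[OF w]] fun_eq_iff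
      by (simp add: vec_eq_iff distrib_right sum.distrib sum_distrib_left mult.assoc)
  qed
  have bounded: "\<exists>K. \<forall>v. rub S v \<longrightarrow> sup_norm (?T t v) \<le> K * sup_norm v" if t: "t \<ge> 0" for t
  proof (cases "t = 0")
    case True
    then show ?thesis by (intro exI[of _ 1]) (simp add: T_0)
  next
    case False
    then have t: "t > 0" using t by simp
    \<comment> \<open>\<open>C\<close> and \<open>D\<close> bound the passage to eigencoordinates
      and back, so the operator bound is the sum of the scalar bounds weighted by them.\<close>
    obtain C where C: "\<And>k. C k > 0" "\<And>k w. norm (coord k w) \<le> norm w * C k"
      using bounded_linear.pos_bounded[OF bounded_linear_coord] by metis
    obtain D where D: "\<And>k. D k > 0" "\<And>k c. norm (c *s column k Y) \<le> norm c * D k"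
      using bounded_linear.pos_bounded[OF bounded_linear_smult_column] by metis
    let ?m = "\<lambda>k. exp (- (t * Re (b k))) * heat_mass CARD('d) (a k)"
    have "sup_norm (?T t v) \<le> (\<Sum>k\<in>UNIV. ?m k * C k * D k) * sup_norm v" if v: "rub S v" for v
    proof (rule sup_norm_least)
      fix x
      obtain K where K: "\<And>x. norm (v x) \<le> K" using rubD_bounded[OF v] by blast
      have le: "norm (coord k (v \<xi>)) \<le> sup_norm v * C k" for k \<xi>
        using C(1)[of k] C(2)[of k "v \<xi>"] sup_norm_upper[of v, OF K] by (meson mult_right_mono less_imp_le order_trans)
      have "norm (?T t v x) \<le> (\<Sum>k\<in>UNIV. norm (?P k t (\<lambda>\<xi>. coord k (v \<xi>)) x *s column k Y))"
        unfolding semigroup_T_eq[OF t v] by (rule norm_sum)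
      also have "\<dots> \<le> (\<Sum>k\<in>UNIV. ?m k * (sup_norm v * C k) * D k)"
        by (intro sum_mono order_trans[OF D(2)] mult_right_mono norm_scalar_T_le[OF S a t rub_coord[OF v] le]
            less_imp_le[OF D(1)])
      also have "\<dots> = (\<Sum>k\<in>UNIV. ?m k * C k * D k) * sup_norm v"
        unfolding sum_distrib_right by (intro sum.cong refl) (simp only: mult_ac)
      finally show "norm (?T t v x) \<le> (\<Sum>k\<in>UNIV. ?m k * C k * D k) * sup_norm v" .
    qed
    then show ?thesis by blast
  qed
  have add: "?T (s + t) v = ?T s (?T t v)" if s: "s \<ge> 0" and t: "t \<ge> 0" and v: "rub S v" for s t v
  proof (cases "s = 0 \<or> t = 0")
    case True
    then show ?thesis by (auto simp: T_0)
  next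
    case False
    then have s: "s > 0" and t: "t > 0" using s t by auto
    \<comment> \<open>Coordinates with respect to a basis are unique, so the scalar semigroup law
      applies to each of them.\<close>
    have coord_T: "coord k (?T t v \<xi>) = ?P k t (\<lambda>\<xi>. coord k (v \<xi>)) \<xi>" for k \<xi>
      unfolding semigroup_T_eq[OF t v] by (rule coord_sum)
    show ?thesis
      unfolding fun_eq_iff semigroup_T_eq[OF s closed[OF less_imp_le[OF t] v]] coord_T
        semigroup_T_eq[OF add_pos_pos[OF s t] v] scalar_T_add[OF S a s t rub_coord[OF v]] by simp
  qed
  have continuous: "((\<lambda>t. sup_norm (\<lambda>x. ?T t v x - v x)) \<longlongrightarrow> 0) (at_right 0)" if v: "rub S v" for v
  proof (rule tendstoI)
    fix e :: real assume e: "e > 0"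
    obtain D where D: "\<And>k. D k > 0" "\<And>k c. norm (c *s column k Y) \<le> norm c * D k"
      using bounded_linear.pos_bounded[OF bounded_linear_smult_column] by metis
    \<comment> \<open>The weighted scalar errors add up to \<open>e / 2\<close>, which leaves room
      for a strict bound after taking the supremum.\<close>
    define \<epsilon> where "\<epsilon> = e / (2 * (\<Sum>k\<in>UNIV. D k))"
    have sumD: "(\<Sum>k\<in>UNIV. D k) > 0" by (intro sum_pos D) auto
    then have eps: "\<epsilon> > 0" "\<epsilon> * (\<Sum>k\<in>UNIV. D k) = e / 2" using e by (auto simp: \<epsilon>_def)
    \<comment> \<open>There are finitely many coordinates, so one time threshold serves them
      all.\<close>
    have "\<forall>\<^sub>F t in at_right 0. \<forall>k. \<forall>x. norm (?P k t (\<lambda>\<xi>. coord k (v \<xi>)) x - coord k (v x)) \<le> \<epsilon>"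
      by (intro eventually_all_finite scalar_T_strongly_continuous[OF S a rub_coord[OF v] eps(1)])
    moreover have "\<forall>\<^sub>F t::real in at_right 0. t > 0"
      by (rule eventually_at_right_less)
    ultimately show "\<forall>\<^sub>F t in at_right 0. dist (sup_norm (\<lambda>x. ?T t v x - v x)) 0 < e"
    proof eventually_elim
      case (elim t)
      have le: "norm (?T t v x - v x) \<le> e / 2" for x
      proof -
        have "?T t v x - v x = (\<Sum>k\<in>UNIV. (?P k t (\<lambda>\<xi>. coord k (v \<xi>)) x - coord k (v x)) *s column k Y)"
          unfolding semigroup_T_eq[OF elim(2) v]
          by (subst (2) coord_expansion) (simp add: sum_subtractf vector_sub_rdistrib)
        also have "norm \<dots> \<le> (\<Sum>k\<in>UNIV. \<epsilon> * D k)"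
          using elim(1) by (intro norm_sum[THEN order_trans] sum_mono order_trans[OF D(2)] mult_right_mono less_imp_le[OF D(1)]) auto
        also have "\<dots> = e / 2"
          using eps(2) by (simp add: sum_distrib_left)
        finally show ?thesis .
      qed
      have "0 \<le> sup_norm (\<lambda>x. ?T t v x - v x)"
        using sup_norm_upper[of "\<lambda>x. ?T t v x - v x", OF le, of undefined] norm_ge_zero order_trans by blast
      moreover have "sup_norm (\<lambda>x. ?T t v x - v x) \<le> e / 2"
        by (rule sup_norm_least) (rule le)
      ultimately show ?case using e by simp
    qed
  qed
  show ?thesis
    unfolding C0_semigroup_on_def C_rub_iff Ball_def
    using closed linear bounded T_0 add continuous by simp
qed

end

theorem theorem6p3:
  fixes A B :: "complex ^ 'n ^ 'n" and S :: "real ^ 'd ^ 'd"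
  assumes "CARD('d) \<ge> 2"
    and "simultaneously_diagonalizable A B"
    and "\<And>l. mat_eigenvalue A l \<Longrightarrow> Re l > 0"
    and "transpose S = - S"
  shows "C0_semigroup_on (C_rub S) (semigroup_T A B S)"
proof -
  obtain Y a b where Y: "invertible Y" and A: "A = conj_diag Y a" and B: "B = conj_diag Y b"
    using assms(2) unfolding simultaneously_diagonalizable_def conj_diag_def by blast
  have "Re (a k) > 0" for k
    using assms(3) mat_eigenvalue_conj_diag[OF Y] unfolding A by blast
  then show ?thesis
    unfolding A B by (intro C0_semigroup_conj_diag Y assms(4))
qed

end
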